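(* Let $Q$ be any positive odd integer. Then the function $F\to\mathbb{C}$, $g\mapsto \mathrm{Col}_Q(g)$, is of positive type on the Thompson group $F$, where for $g=g(T_1,T_2)$ with $T_1,T_2\in\mathcal{T}_n$ one sets $\mathrm{Col}_Q(g)=\mathrm{Col}_Q(L(T_1,T_2))\,Q^{-n}$.
   Context: **Trees and the Thompson group.** $\mathcal{T}_n$ is the set of rooted planar binary trees (every internal vertex has a left and a right child) with $n$ leaves, the leaves being numbered $1,\dots,n$ from left to right. To the root associate $[0,1]$ and, recursively, to the left/right child of a vertex with interval $I$ the left/right half of $I$; the leaves of $T\in\mathcal{T}_n$ then give a subdivision of $[0,1]$ into $n$ standard dyadic intervals. For $T_+,T_-\in\mathcal{T}_n$, $g(T_+,T_-)$ is the homeomorphism of $[0,1]$ mapping, for each $k$, the interval of the $k$-th leaf of $T_-$ linearly and increasingly onto the interval of the $k$-th leaf of $T_+$. The group $F$ (under composition) consists of all these homeomorphisms; $g(T_+,T_-)^{-1}=g(T_-,T_+)$. Two pairs of trees define the same element of $F$ iff they are connected by a sequence of additions/deletions of opposite carets (adding a pair of opposite carets means: for some $k$, attach to the $k$-th leaf of both trees two children). **The signed graph $\Gamma(T_+,T_-)$.** For $T\in\mathcal{T}_n$ let $\Gamma_\pm(T)$ be the following tree on the vertices $0,1,\dots,n-1$ (vertex $k\geq 1$ lies between leaves $k$ and $k+1$, vertex $0$ lies to the left of leaf $1$): for every internal vertex $v$ of $T$ whose left subtree has leaves $a,\dots,m$ and whose right subtree has leaves $m+1,\dots,b$ there is one edge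 joining $a-1$ and $m$. (This is the part of the dual graph of $T$ given by the edges of $T$ going from a left child up to its parent.) $\Gamma(T_+,T_-)$ is the signed planar multigraph on the vertices $0,\dots,n-1$ (placed in order on the $x$-axis) obtained as the union of $\Gamma_+(T_+)$, drawn by non-crossing arches in the upper half plane with edges signed $+$, and $\Gamma_-(T_-)$, drawn by non-crossing arches in the lower half plane with edges signed $-$; parallel edges are kept. **The link diagram $L(T_+,T_-)$.** Take the medial graph of the plane graph $\Gamma(T_+,T_-)$: the 4-regular plane graph with one vertex at the midpoint of each edge of $\Gamma$, in which midpoints of edges that are consecutive along the boundary of a face are joined by an arc inside that face (for a single vertex without edges take a circle). At the midpoint of an edge the arch is horizontal and the two strands of the medial graph cross there with slopes $+1$ and $-1$. Turn each medial vertex into a crossing: for $+$ edges (upper half plane) the strand of slope $+1$ passes over; for $-$ edges (lower half plane) the strand of slope $-1$ passes over. The result is the unoriented link diagram $L(T_+,T_-)$. **Colourings.** A $Q$-colouring of a link diagram is an assignment of an element of $\mathbb{Z}_Q=\mathbb{Z}/Q\mathbb{Z}$ to every arc of the diagram (arcs run from undercrossing to undercrossing) such that at each crossing the sum of the colours of the two under-arcs equals twice the colour of the over-arc in $\mathbb{Z}_Q$. The number of $Q$-colourings (constant ones included) is a link invariant, denoted $\mathrm{Col}_Q(L)$. The value $\mathrm{Col}_Q(g)$ does not depend on the choice of the pair $(T_1,T_2)$ representing $g$. **Positive type.** A function $\phi:G\to\mathbb{C}$ on a discrete group $G$ is of positive type if for all $r$ and all $g_1,\dots,g_r\in G$ the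 matrix $(\phi(g_ig_j^{-1}))_{i,j=1}^r$ is positive semidefinite (in particular Hermitian). *)

theory Defs
  imports
    Complex_Main
    "HOL-Algebra.Bij"
    "HOL-Combinatorics.Cycles"
    "HOL-Number_Theory.Cong"
begin

section \<open>Binary trees and the Thompson group\<close>

datatype bintree = Leaf | Node bintree bintree

fun leaves :: "bintree \<Rightarrow> nat" where
  "leaves Leaf = 1"
| "leaves (Node l r) = leaves l + leaves r"

definition trees :: "nat \<Rightarrow> bintree set" where
  "trees n = {T. leaves T = n}"

fun intervals :: "real \<times> real \<Rightarrow> bintree \<Rightarrow> (real \<times> real) list" where
  "intervals (a, b) Leaf = [(a, b)]"
| "intervals (a, b) (Node l r) = intervals (a, (a + b) / 2) l @ intervals ((a + b) / 2, b) r"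

definition leaf_intervals :: "bintree \<Rightarrow> (real \<times> real) list" where
  "leaf_intervals T = intervals (0, 1) T"

text \<open>The homeomorphism \<open>g(T\<^sub>+, T\<^sub>-)\<close> of \<open>[0,1]\<close>, as an extensional function.
  The index \<open>k\<close> (counted from 0) is that of the first leaf interval of \<open>T\<^sub>-\<close> containing \<open>x\<close>; at a
  common endpoint of two neighbouring intervals both affine pieces have the same value.\<close>

definition thompson_map :: "bintree \<Rightarrow> bintree \<Rightarrow> real \<Rightarrow> real" where
  "thompson_map Tp Tm = (\<lambda>x\<in>{0..1}.
     let k = (LEAST k. x \<le> snd (leaf_intervals Tm ! k));
         (a, b) = leaf_intervals Tm ! k;
         (c, d) = leaf_intervals Tp ! k
     in c + (x - a) * (d - c) / (b - a))"

definition thompson_group :: "(real \<Rightarrow> real) monoid" where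
  "thompson_group = BijGroup {0..1}
     \<lparr>carrier := {thompson_map Tp Tm | n Tp Tm. Tp \<in> trees n \<and> Tm \<in> trees n}\<rparr>"


section \<open>Signed arch graphs\<close>

datatype sign = Positive | Negative

text \<open>A plane multigraph whose vertices are natural numbers placed in order on the \<open>x\<close>-axis.
  An edge is a triple \<open>(s, i, j)\<close> with \<open>i < j\<close>, drawn as an arch from \<open>i\<close> to \<open>j\<close> in the upper half
  plane if \<open>s = Positive\<close> and in the lower half plane if \<open>s = Negative\<close>.\<close>

record arch_graph =
  verts :: "nat set"
  edges :: "(sign \<times> nat \<times> nat) set"

text \<open>\<open>arches s T\<close> are the edges of the tree \<open>\<Gamma>\<^sub>\<plusminus>(T)\<close> when the leaves of \<open>T\<close> are numbered
  \<open>s + 1, s + 2, \<dots>\<close> from left to right: the root of \<open>Node l r\<close> has left leaves \<open>a, \<dots>, m\<close> with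
  \<open>a - 1 = s\<close> and \<open>m = s + leaves l\<close>. Distinct internal vertices have distinct \<open>m\<close>, so no
  parallel edges are lost by taking a set.\<close>

fun arches :: "nat \<Rightarrow> bintree \<Rightarrow> (nat \<times> nat) set" where
  "arches s Leaf = {}"
| "arches s (Node l r) = {(s, s + leaves l)} \<union> arches s l \<union> arches (s + leaves l) r"

definition Gamma :: "bintree \<Rightarrow> bintree \<Rightarrow> arch_graph" where
  "Gamma Tp Tm = \<lparr>verts = {..<leaves Tp},
     edges = {Positive} \<times> arches 0 Tp \<union> {Negative} \<times> arches 0 Tm\<rparr>"

text \<open>A dart \<open>(s, v, w)\<close> is the half at \<open>v\<close> of the edge of sign \<open>s\<close> joining \<open>v\<close> and \<open>w\<close>.\<close>

type_synonym dart = "sign \<times> nat \<times> nat"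

definition darts :: "arch_graph \<Rightarrow> dart set" where
  "darts G = edges G \<union> {(s, j, i) | s i j. (s, i, j) \<in> edges G}"

definition half_star :: "arch_graph \<Rightarrow> sign \<Rightarrow> nat \<Rightarrow> dart list" where
  "half_star G s v =
     map (\<lambda>w. (s, v, w))
       (sorted_list_of_set {w. (s, v, w) \<in> edges G} @ sorted_list_of_set {u. (s, u, v) \<in> edges G})"

text \<open>The darts at \<open>v\<close> in counterclockwise order, starting from the positive \<open>x\<close>-direction.
  In the upper half plane the arches going right come first, the one with the nearest endpoint
  being the lowest, then those going left, the one with the farthest endpoint being the
  highest. The lower half plane is the mirror image, hence passed through in reverse order.\<close>

definition star :: "arch_graph \<Rightarrow> nat \<Rightarrow> dart list" where
  "star G v = half_star G Positive v @ rev (half_star G Negative v)"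

definition clockwise :: "arch_graph \<Rightarrow> dart \<Rightarrow> dart" where
  "clockwise G d = cycle_of_list (rev (star G (fst (snd d)))) d"


section \<open>Link diagrams and colourings\<close>

text \<open>An unoriented link diagram, seen as a 4-regular plane graph with over/under information:
  \<open>segments\<close> are the edges of the 4-regular graph (and possible circles without crossings). At a
  crossing \<open>c\<close> the segments \<open>fst (over c)\<close> and \<open>snd (over c)\<close> form the strand passing over, and
  those of \<open>under c\<close> the strand passing under.\<close>

record ('s, 'c) link_diagram =
  segments :: "'s set"
  crossings :: "'c set"
  over :: "'c \<Rightarrow> 's \<times> 's"
  under :: "'c \<Rightarrow> 's \<times> 's"

text \<open>Arcs run from undercrossing to undercrossing: they are the classes of segments under
  continuation through overcrossings.\<close>

definition arc_rel :: "('s, 'c) link_diagram \<Rightarrow> ('s \<times> 's) set" where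
  "arc_rel D = {(s, t). s \<in> segments D \<and> t \<in> segments D \<and>
     equivclp (\<lambda>s t. \<exists>c\<in>crossings D. over D c = (s, t)) s t}"

definition arcs :: "('s, 'c) link_diagram \<Rightarrow> 's set set" where
  "arcs D = segments D // arc_rel D"

definition arc_of :: "('s, 'c) link_diagram \<Rightarrow> 's \<Rightarrow> 's set" where
  "arc_of D s = arc_rel D `` {s}"

text \<open>\<open>\<int>/Q\<int>\<close> is represented by the residues \<open>{0..<Q}\<close>.\<close>

definition colourings :: "nat \<Rightarrow> ('s, 'c) link_diagram \<Rightarrow> ('s set \<Rightarrow> int) set" where
  "colourings Q D = {f \<in> arcs D \<rightarrow>\<^sub>E {0..<int Q}. \<forall>c\<in>crossings D.
     [f (arc_of D (fst (under D c))) + f (arc_of D (snd (under D c)))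
       = 2 * f (arc_of D (fst (over D c)))] (mod int Q)}"

definition Col :: "nat \<Rightarrow> ('s, 'c) link_diagram \<Rightarrow> nat" where
  "Col Q D = card (colourings Q D)"


section \<open>The link diagram of a pair of trees\<close>

text \<open>The edges of the medial graph correspond to the corners of the plane graph, i.e. to the pairs
  of consecutive darts at a vertex: these are the pairs of edges that are consecutive along the
  boundary of a face. \<open>Corner d\<close> lies between \<open>d\<close> and the next dart counterclockwise at the same
  vertex. A vertex without edges contributes a circle.\<close>

datatype medial_edge = Corner dart | Circle nat

text \<open>The four medial edges meeting at the midpoint of the arch \<open>(s, i, j)\<close>, \<open>i < j\<close>, named after
  the direction in which they leave it. Seen from \<open>i\<close>, the side of the arch facing north is
  the counterclockwise one; seen from \<open>j\<close> it is the clockwise one. This holds in both half planes.\<close>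

fun NW :: "arch_graph \<Rightarrow> sign \<times> nat \<times> nat \<Rightarrow> medial_edge" where
  "NW G (s, i, j) = Corner (s, i, j)"

fun SW :: "arch_graph \<Rightarrow> sign \<times> nat \<times> nat \<Rightarrow> medial_edge" where
  "SW G (s, i, j) = Corner (clockwise G (s, i, j))"

fun SE :: "arch_graph \<Rightarrow> sign \<times> nat \<times> nat \<Rightarrow> medial_edge" where
  "SE G (s, i, j) = Corner (s, j, i)"

fun NE :: "arch_graph \<Rightarrow> sign \<times> nat \<times> nat \<Rightarrow> medial_edge" where
  "NE G (s, i, j) = Corner (clockwise G (s, j, i))"

definition rising :: "arch_graph \<Rightarrow> sign \<times> nat \<times> nat \<Rightarrow> medial_edge \<times> medial_edge" where
  "rising G e = (SW G e, NE G e)"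

definition falling :: "arch_graph \<Rightarrow> sign \<times> nat \<times> nat \<Rightarrow> medial_edge \<times> medial_edge" where
  "falling G e = (NW G e, SE G e)"

definition medial_diagram :: "arch_graph \<Rightarrow> (medial_edge, sign \<times> nat \<times> nat) link_diagram" where
  "medial_diagram G =
     \<lparr>segments = Corner ` darts G \<union> Circle ` {v \<in> verts G. \<forall>s w. (s, v, w) \<notin> darts G},
      crossings = edges G,
      over = (\<lambda>e. if fst e = Positive then rising G e else falling G e),
      under = (\<lambda>e. if fst e = Positive then falling G e else rising G e)\<rparr>"

definition L :: "bintree \<Rightarrow> bintree \<Rightarrow> (medial_edge, sign \<times> nat \<times> nat) link_diagram" where
  "L Tp Tm = medial_diagram (Gamma Tp Tm)"

definition Col_F :: "nat \<Rightarrow> (real \<Rightarrow> real) \<Rightarrow> complex" where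
  "Col_F Q g = (THE z. \<exists>n. \<exists>T1\<in>trees n. \<exists>T2\<in>trees n.
     g = thompson_map T1 T2 \<and> z = of_nat (Col Q (L T1 T2)) / of_nat Q ^ n)"


section \<open>Functions of positive type\<close>

definition positive_semidefinite :: "nat \<Rightarrow> (nat \<Rightarrow> nat \<Rightarrow> complex) \<Rightarrow> bool" where
  "positive_semidefinite r A \<longleftrightarrow>
     (\<forall>i<r. \<forall>j<r. A i j = cnj (A j i)) \<and>
     (\<forall>x. (\<Sum>i<r. \<Sum>j<r. cnj (x i) * A i j * x j) \<in> \<real> \<and>
          0 \<le> Re (\<Sum>i<r. \<Sum>j<r. cnj (x i) * A i j * x j))"

definition positive_type :: "('a, 'b) monoid_scheme \<Rightarrow> ('a \<Rightarrow> complex) \<Rightarrow> bool" where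
  "positive_type G \<phi> \<longleftrightarrow>
     (\<forall>r g. (\<forall>i<r. g i \<in> carrier G) \<longrightarrow>
        positive_semidefinite r (\<lambda>i j. \<phi> (g i \<otimes>\<^bsub>G\<^esub> inv\<^bsub>G\<^esub> g j)))"

end

(* A colouring of the tangle above (or below) the x-axis is determined by its colours r_v, l_v on
   the two segments crossing the axis to the right and to the left of each vertex v. If V_T is the
   set of boundary colourings that extend over the half-plane tangle of the tree T, then, since the
   two half planes are mirror images, Col_Q(L(A, B)) is the cardinality of the intersection of V_A
   and V_B. Adding a pair of opposite carets multiplies this number by Q, so Col_Q(g) is well
   defined. Finitely many elements of F can be written as g(T_i, S) with a common tree S with n
   leaves; then g_i g_j^-1 = g(T_i, T_j), and the matrix in question is Q^-n times the Gram matrix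
   of the indicator functions of the sets V_(T_i). *)

theory Submission
  imports Defs
begin

section \<open>Thompson maps\<close>

text \<open>Reflection in the x-axis exchanges the slopes +1 and -1, and the over-strands at
  \<open>Positive\<close> and \<open>Negative\<close> crossings are chosen so that it carries the
  lower tangle of a tree to its upper tangle. The colouring condition is insensitive to reflection,
  so one set serves both positions of the tree; this turns the count into an inner product. The set
  is accessible by recursion because the arch of the root is outermost: it is the last dart passed
  at each of its ends, and only one colour coming out of each subtree meets it. The factor
  \<open>Q\<close> is the number of choices for the over-strand of the new innermost arch;
  reflection in that colour then fixes the rest. Well-definedness requires no chain of carets
  between two given representations: both are refined to the same second tree, and for a fixed
  second tree the homeomorphism determines the first.\<close>

fun piecewise_affine :: "(real \<times> real) list \<Rightarrow> (real \<times> real) list \<Rightarrow> real \<Rightarrow> real" where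
  "piecewise_affine ((a, b) # Is) ((c, d) # Js) x =
     (if x \<le> b then c + (x - a) * (d - c) / (b - a) else piecewise_affine Is Js x)"
| "piecewise_affine _ _ x = 0"

fun subdivision :: "real \<Rightarrow> real \<Rightarrow> (real \<times> real) list \<Rightarrow> bool" where
  "subdivision lo hi [] \<longleftrightarrow> lo = hi"
| "subdivision lo hi ((a, b) # Is) \<longleftrightarrow> a = lo \<and> a < b \<and> subdivision b hi Is"

lemma subdivision_append:
  "subdivision a b Is \<Longrightarrow> subdivision b c Js \<Longrightarrow> subdivision a c (Is @ Js)"
  by (induction a b Is rule: subdivision.induct) auto

lemma subdivision_intervals: "a < b \<Longrightarrow> subdivision a b (intervals (a, b) T)"
proof (induction T arbitrary: a b)
  case (Node l r)
  then show ?case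
    by (auto intro!: subdivision_append[of a "(a + b) / 2"])
qed simp

lemma length_intervals [simp]: "length (intervals (a, b) T) = leaves T"
  by (induction T arbitrary: a b) auto

lemma leaves_pos [simp]: "0 < leaves T"
  by (induction T) auto

lemma subdivision_le: "subdivision lo hi Is \<Longrightarrow> lo \<le> hi"
  by (induction lo hi Is rule: subdivision.induct) auto

lemma subdivision_snd_le:
  "subdivision lo hi Is \<Longrightarrow> (a, b) \<in> set Is \<Longrightarrow> lo \<le> a \<and> a < b \<and> b \<le> hi"
proof (induction lo hi Is rule: subdivision.induct)
  case (2 lo hi a' b' Is)
  then show ?case
    using subdivision_le[of b' hi Is] by auto
qed simp

lemma subdivision_covers:
  "subdivision lo hi Is \<Longrightarrow> Is \<noteq> [] \<Longrightarrow> x \<le> hi \<Longrightarrow> \<exists>k<length Is. x \<le> snd (Is ! k)"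
proof (induction lo hi Is rule: subdivision.induct)
  case (2 lo hi a b Is)
  show ?case
  proof (cases "Is = []")
    case False
    then obtain k where "k < length Is" "x \<le> snd (Is ! k)"
      using 2 by auto
    then show ?thesis
      by (intro exI[of _ "Suc k"]) auto
  qed (use 2 in auto)
qed simp

text \<open>Bridge from the indexed form of \<open>thompson_map\<close> to recursion on interval
  lists, on which the inductions run. Skipping the head interval shifts the least index by
  one.\<close>

lemma piecewise_affine_Least:
  assumes "length Is = length Js" "\<exists>k<length Is. x \<le> snd (Is ! k)"
  shows "(let k = (LEAST k. x \<le> snd (Is ! k)); (a, b) = Is ! k; (c, d) = Js ! k
      in c + (x - a) * (d - c) / (b - a)) = piecewise_affine Is Js x"
  using assms
proof (induction Is Js rule: list_induct2)
  case (Cons I Is J Js)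
  obtain a b c d where IJ: "I = (a, b)" "J = (c, d)"
    by (cases I, cases J) auto
  show ?case
  proof (cases "x \<le> b")
    case True
    then have "(LEAST k. x \<le> snd ((I # Is) ! k)) = 0"
      by (intro Least_eq_0) (simp add: IJ)
    then show ?thesis
      using True by (simp add: IJ)
  next
    case False
    obtain k where k: "k < Suc (length Is)" "x \<le> snd ((I # Is) ! k)"
      using Cons.prems by auto
    have "k \<noteq> 0"
      using k False by (auto simp: IJ intro: ccontr)
    then have "\<exists>k<length Is. x \<le> snd (Is ! k)"
      using k by (intro exI[of _ "k - 1"]) (auto simp: nth_Cons')
    moreover have "(LEAST k. x \<le> snd ((I # Is) ! k)) = Suc (LEAST k. x \<le> snd (Is ! k))"
      using Least_Suc[of "\<lambda>k. x \<le> snd ((I # Is) ! k)" k] k False by (simp add: IJ)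
    ultimately show ?thesis
      using Cons.IH False by (simp add: IJ Let_def)
  qed
qed simp

lemma leaf_intervals_subdivision: "subdivision 0 1 (leaf_intervals T)"
  by (simp add: leaf_intervals_def subdivision_intervals)

lemma length_leaf_intervals [simp]: "length (leaf_intervals T) = leaves T"
  by (simp add: leaf_intervals_def)

lemma thompson_map_eq_piecewise_affine:
  assumes "leaves Tp = leaves Tm"
  shows "thompson_map Tp Tm =
    (\<lambda>x\<in>{0..1}. piecewise_affine (leaf_intervals Tm) (leaf_intervals Tp) x)"
  unfolding thompson_map_def
proof (intro restrict_ext piecewise_affine_Least)
  fix x :: real
  assume "x \<in> {0..1}"
  then show "\<exists>k<length (leaf_intervals Tm). x \<le> snd (leaf_intervals Tm ! k)"
    using leaves_pos[of Tm]
    by (intro subdivision_covers[OF leaf_intervals_subdivision])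
      (auto simp flip: length_leaf_intervals)
qed (simp add: assms)

lemma affine_in_interval:
  fixes a b c d x :: real
  assumes "a < b" "c < d" "a \<le> x" "x \<le> b"
  shows "c \<le> c + (x - a) * (d - c) / (b - a)" "c + (x - a) * (d - c) / (b - a) \<le> d"
proof -
  show "c \<le> c + (x - a) * (d - c) / (b - a)"
    using assms by simp
  have "(x - a) * (d - c) \<le> (b - a) * (d - c)"
    using assms by (intro mult_right_mono) auto
  then have "(x - a) * (d - c) / (b - a) \<le> d - c"
    using assms by (simp add: pos_divide_le_eq mult.commute)
  then show "c + (x - a) * (d - c) / (b - a) \<le> d"
    by simp
qed

text \<open>Strictness at the left end serves \<open>piecewise_affine_comp\<close>: a point beyond
  the first interval must go strictly beyond the first target interval, so that the second map skips
  its head as well.\<close>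

lemma piecewise_affine_in_interval:
  assumes "length Is = length Js" "subdivision lo hi Is" "subdivision lo' hi' Js"
    "lo < x" "x \<le> hi"
  shows "lo' < piecewise_affine Is Js x \<and> piecewise_affine Is Js x \<le> hi'"
  using assms
proof (induction Is Js arbitrary: lo lo' rule: list_induct2)
  case (Cons I Is J Js)
  obtain a b c d where IJ: "I = (a, b)" "J = (c, d)"
    by (cases I, cases J) auto
  show ?case
  proof (cases "x \<le> b")
    case True
    have "0 < (x - a) * (d - c) / (b - a)"
      using Cons.prems by (simp add: IJ)
    moreover have "c + (x - a) * (d - c) / (b - a) \<le> d"
      using Cons.prems True by (intro affine_in_interval) (auto simp: IJ)
    ultimately show ?thesis
      using Cons.prems True subdivision_le[of d hi' Js] by (simp add: IJ)
  next
    case False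
    then show ?thesis
      using Cons.prems Cons.IH[of b d] by (auto simp: IJ)
  qed
qed simp

lemma piecewise_affine_comp:
  assumes "length Is = length Js" "length Js = length Ks"
    "subdivision lo hi Is" "subdivision lo' hi' Js"
    "lo \<le> x" "x \<le> hi"
  shows "piecewise_affine Js Ks (piecewise_affine Is Js x) = piecewise_affine Is Ks x"
  using assms
proof (induction Is Js Ks arbitrary: lo lo' rule: list_induct3)
  case (Cons I Is J Js K Ks)
  obtain a b c d e f where IJ: "I = (a, b)" "J = (c, d)" "K = (e, f)"
    by (cases I, cases J, cases K) auto
  show ?case
  proof (cases "x \<le> b")
    case True
    then have "c + (x - a) * (d - c) / (b - a) \<le> d"
      using Cons.prems by (intro affine_in_interval) (auto simp: IJ)
    then show ?thesis
      using Cons.prems True by (simp add: IJ)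
  next
    case False
    then have "d < piecewise_affine Is Js x"
      using piecewise_affine_in_interval[of Is Js b hi d hi' x] Cons.hyps Cons.prems
      by (simp add: IJ)
    then show ?thesis
      using False Cons.prems Cons.IH[of b d] by (simp add: IJ)
  qed
qed simp

lemma piecewise_affine_self:
  assumes "subdivision lo hi Is" "Is \<noteq> []" "x \<le> hi"
  shows "piecewise_affine Is Is x = x"
  using assms
proof (induction lo hi Is rule: subdivision.induct)
  case (2 lo hi a b Is)
  then show ?case
    by (cases "Is = []") auto
qed simp

text \<open>At the right endpoint of the first interval the value is the right endpoint of its
  target, so the targets can be read off one by one. Asking for equality only to the right of
  \<open>lo\<close> lets the hypothesis pass to the tails.\<close>

lemma piecewise_affine_inject:
  assumes "length Is = length Js" "length Js = length Ks"
    "subdivision lo hi Is" "subdivision lo' hi' Js" "subdivision lo' hi' Ks"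
    "\<And>x. lo < x \<Longrightarrow> x \<le> hi \<Longrightarrow> piecewise_affine Is Js x = piecewise_affine Is Ks x"
  shows "Js = Ks"
  using assms
proof (induction Is Js Ks arbitrary: lo lo' rule: list_induct3)
  case (Cons I Is J Js K Ks)
  obtain a b c d e f where IJ: "I = (a, b)" "J = (c, d)" "K = (e, f)"
    by (cases I, cases J, cases K) auto
  have ab: "a = lo" "a < b" "c = lo'" "e = lo'" "b \<le> hi"
    using Cons.prems subdivision_le by (auto simp: IJ)
  have "d = f"
    using ab Cons.prems(4)[of b] by (simp add: IJ)
  moreover have "Js = Ks"
  proof (rule Cons.IH)
    fix x assume "b < x" "x \<le> hi"
    then show "piecewise_affine Is Js x = piecewise_affine Is Ks x"
      using ab Cons.prems(4)[of x] by (simp add: IJ)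
  qed (use Cons.prems \<open>d = f\<close> in \<open>auto simp: IJ\<close>)
  ultimately show ?case
    using ab by (simp add: IJ)
qed simp

text \<open>Halving an interval together with its target keeps the slope, so both halves continue
  the same affine piece.\<close>

lemma piecewise_affine_bisect:
  assumes "length Is = length Js" "a < b"
  shows "piecewise_affine (Is @ (a, (a + b) / 2) # ((a + b) / 2, b) # Is')
      (Js @ (c, (c + d) / 2) # ((c + d) / 2, d) # Js') x
    = piecewise_affine (Is @ (a, b) # Is') (Js @ (c, d) # Js') x"
  using assms
proof (induction Is Js rule: list_induct2)
  case Nil
  then show ?case
    by (auto simp: field_simps)
next
  case (Cons I Is J Js)
  then show ?case
    by (cases I; cases J) simp
qed

text \<open>The intervals ending at or before the midpoint are those of the left subtree, so the
  list can be cut in a unique way and both halves are treated recursively.\<close>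

lemma intervals_inject:
  "a < b \<Longrightarrow> intervals (a, b) S = intervals (a, b) T \<Longrightarrow> S = T"
proof (induction S arbitrary: T a b)
  case Leaf
  show ?case
  proof (cases T)
    case (Node l r)
    then have "Suc 0 = leaves l + leaves r"
      using arg_cong[OF Leaf(2), of length] by simp
    then show ?thesis
      using leaves_pos[of l] leaves_pos[of r] by linarith
  qed simp
next
  case (Node l r)
  show ?case
  proof (cases T)
    case Leaf
    then have "Suc 0 = leaves l + leaves r"
      using arg_cong[OF Node.prems(2), of length] by simp
    then show ?thesis
      using leaves_pos[of l] leaves_pos[of r] by linarith
  next
    case T: (Node l' r')
    let ?m = "(a + b) / 2"
    have m: "a < ?m" "?m < b"
      using Node.prems(1) by auto
    have left: "filter (\<lambda>I. snd I \<le> ?m) (intervals (a, ?m) t) = intervals (a, ?m) t" for t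
      using subdivision_snd_le[OF subdivision_intervals[OF m(1)]] by (auto simp: filter_id_conv)
    have right: "filter (\<lambda>I. snd I \<le> ?m) (intervals (?m, b) t) = []" for t
      using subdivision_snd_le[OF subdivision_intervals[OF m(2)]]
      by (force simp: filter_empty_conv)
    have "intervals (a, ?m) l = intervals (a, ?m) l'"
      using arg_cong[OF Node.prems(2), of "filter (\<lambda>I. snd I \<le> ?m)"]
      unfolding T intervals.simps filter_append left right by simp
    moreover from this have "intervals (?m, b) r = intervals (?m, b) r'"
      using Node.prems(2) by (simp add: T)
    ultimately show ?thesis
      using Node.IH(1)[OF m(1)] Node.IH(2)[OF m(2)] by (simp add: T)
  qed
qed

section \<open>Composition, injectivity and bijectivity of Thompson maps\<close>

lemma thompson_map_in_range:
  assumes "leaves A = leaves B" "x \<in> {0..1}"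
  shows "thompson_map A B x \<in> {0..1}"
\<comment> \<open>The interval estimate requires a point strictly to the right of the left end, so 0
  is computed by hand.\<close>
proof (cases "x = 0")
  case True
  obtain a b I c d J where "leaf_intervals A = (a, b) # I" "leaf_intervals B = (c, d) # J"
    using leaves_pos[of A] leaves_pos[of B]
    by (metis length_leaf_intervals length_greater_0_conv list.exhaust prod.exhaust)
  then show ?thesis
    using leaf_intervals_subdivision[of A] leaf_intervals_subdivision[of B] True assms
    by (auto simp: thompson_map_eq_piecewise_affine dest: subdivision_le)
next
  case False
  then have "0 < piecewise_affine (leaf_intervals B) (leaf_intervals A) x \<and>
      piecewise_affine (leaf_intervals B) (leaf_intervals A) x \<le> 1"
    using assms
    by (intro piecewise_affine_in_interval[OF _ leaf_intervals_subdivision leaf_intervals_subdivision])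
      auto
  then show ?thesis
    using assms by (simp add: thompson_map_eq_piecewise_affine)
qed

lemma thompson_map_comp:
  assumes "leaves A = leaves B" "leaves B = leaves C"
  shows "compose {0..1} (thompson_map A B) (thompson_map B C) = thompson_map A C"
proof (rule extensionalityI[where A = "{0..1}"])
  fix x :: real
  assume x: "x \<in> {0..1}"
  have "thompson_map A B (thompson_map B C x) = thompson_map A C x"
    using x assms thompson_map_in_range[of B C x]
      piecewise_affine_comp[OF _ _ leaf_intervals_subdivision leaf_intervals_subdivision,
        of C B "leaf_intervals A" x]
    by (simp add: thompson_map_eq_piecewise_affine)
  then show "compose {0..1} (thompson_map A B) (thompson_map B C) x = thompson_map A C x"
    using x by (simp add: compose_eq)
qed (simp_all add: thompson_map_def)

lemma thompson_map_self: "thompson_map A A = (\<lambda>x\<in>{0..1}. x)"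
  unfolding thompson_map_eq_piecewise_affine[OF refl]
proof (intro restrict_ext piecewise_affine_self[OF leaf_intervals_subdivision])
  show "leaf_intervals A \<noteq> []"
    using leaves_pos[of A] by (auto simp flip: length_leaf_intervals)
qed simp

lemma thompson_map_inject:
  assumes "leaves A = leaves S" "leaves B = leaves S" "thompson_map A S = thompson_map B S"
  shows "A = B"
proof -
  have "leaf_intervals A = leaf_intervals B"
  proof (rule piecewise_affine_inject[of "leaf_intervals S" _ _ 0 1 0 1])
    fix x :: real
    assume "0 < x" "x \<le> 1"
    then show "piecewise_affine (leaf_intervals S) (leaf_intervals A) x
        = piecewise_affine (leaf_intervals S) (leaf_intervals B) x"
      using fun_cong[OF assms(3), of x] assms(1,2)
      by (simp add: thompson_map_eq_piecewise_affine)
  qed (use assms in \<open>simp_all add: leaf_intervals_subdivision\<close>)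
  then show ?thesis
    by (intro intervals_inject[of 0 1]) (simp_all add: leaf_intervals_def)
qed

lemma thompson_map_in_Bij:
  assumes "leaves A = leaves B"
  shows "thompson_map A B \<in> Bij {0..1}"
proof -
  have inverse: "thompson_map S T (thompson_map T S x) = x"
    if "leaves S = leaves T" "x \<in> {0..1}" for S T x
    using fun_cong[OF thompson_map_comp[OF that(1) that(1)[symmetric]], of x] that(2)
    by (simp add: thompson_map_self compose_eq)
  have "bij_betw (thompson_map A B) {0..1} {0..1}"
    using assms
    by (intro bij_betwI[where g = "thompson_map B A"])
      (simp_all add: inverse thompson_map_in_range del: atLeastAtMost_iff)
  then show ?thesis
    by (simp add: Bij_def thompson_map_def extensional_def)
qed

section \<open>Group operations in terms of pairs of trees\<close>

lemma thompson_group_mult: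
  assumes "leaves A = leaves B" "leaves B = leaves C"
  shows "thompson_map A B \<otimes>\<^bsub>thompson_group\<^esub> thompson_map B C = thompson_map A C"
  using assms
  by (simp add: thompson_group_def BijGroup_def thompson_map_in_Bij thompson_map_comp)

lemma thompson_group_one: "\<one>\<^bsub>thompson_group\<^esub> = thompson_map A A"
  by (simp add: thompson_group_def BijGroup_def thompson_map_self)

lemma thompson_map_in_carrier:
  "leaves A = leaves B \<Longrightarrow> thompson_map A B \<in> carrier thompson_group"
  by (simp add: thompson_group_def trees_def) metis

lemma thompson_group_cases:
  assumes "g \<in> carrier thompson_group"
  obtains A B where "leaves A = leaves B" "g = thompson_map A B"
proof -
  obtain n A B where "g = thompson_map A B" "A \<in> trees n" "B \<in> trees n"
    using assms unfolding thompson_group_def by auto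
  then show thesis
    by (intro that[of A B]) (simp_all add: trees_def)
qed

text \<open>\<open>m_inv\<close> is a definite description over the carrier, so uniqueness has to be
  shown; it is inherited from the group of all bijections of the unit interval, which has the same
  product and unit.\<close>

lemma thompson_group_inv:
  assumes "leaves A = leaves B"
  shows "inv\<^bsub>thompson_group\<^esub> (thompson_map A B) = thompson_map B A"
  unfolding m_inv_def
proof (rule the_equality)
  show "thompson_map B A \<in> carrier thompson_group \<and>
      thompson_map A B \<otimes>\<^bsub>thompson_group\<^esub> thompson_map B A = \<one>\<^bsub>thompson_group\<^esub> \<and>
      thompson_map B A \<otimes>\<^bsub>thompson_group\<^esub> thompson_map A B = \<one>\<^bsub>thompson_group\<^esub>"
  proof (intro conjI)
    show "thompson_map B A \<in> carrier thompson_group"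
      using assms by (intro thompson_map_in_carrier) simp
    show "thompson_map A B \<otimes>\<^bsub>thompson_group\<^esub> thompson_map B A = \<one>\<^bsub>thompson_group\<^esub>"
      unfolding thompson_group_one[of A] by (rule thompson_group_mult[OF assms assms[symmetric]])
    show "thompson_map B A \<otimes>\<^bsub>thompson_group\<^esub> thompson_map A B = \<one>\<^bsub>thompson_group\<^esub>"
      unfolding thompson_group_one[of B] by (rule thompson_group_mult[OF assms[symmetric] assms])
  qed
next
  interpret B: group "BijGroup ({0..1} :: real set)"
    by (rule group_BijGroup)
  fix y
  assume y: "y \<in> carrier thompson_group \<and>
      thompson_map A B \<otimes>\<^bsub>thompson_group\<^esub> y = \<one>\<^bsub>thompson_group\<^esub> \<and>
      y \<otimes>\<^bsub>thompson_group\<^esub> thompson_map A B = \<one>\<^bsub>thompson_group\<^esub>"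
  have mult: "f \<otimes>\<^bsub>thompson_group\<^esub> g = f \<otimes>\<^bsub>BijGroup {0..1}\<^esub> g" for f g
    by (simp add: thompson_group_def)
  have one: "\<one>\<^bsub>thompson_group\<^esub> = \<one>\<^bsub>BijGroup {0..1}\<^esub>"
    by (simp add: thompson_group_def)
  have Bij: "carrier (BijGroup {0..1 :: real}) = Bij {0..1}"
    by (simp add: BijGroup_def)
  obtain A' B' where "leaves A' = leaves B'" "y = thompson_map A' B'"
    using y by (elim conjE thompson_group_cases)
  then have "y \<in> Bij {0..1}"
    by (simp add: thompson_map_in_Bij)
  moreover have "thompson_map A B \<otimes>\<^bsub>BijGroup {0..1}\<^esub> thompson_map B A = \<one>\<^bsub>BijGroup {0..1}\<^esub>"
    using thompson_group_mult[OF assms assms[symmetric]]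
    unfolding thompson_group_one[of A, symmetric] mult one by simp
  ultimately show "y = thompson_map B A"
    using y assms B.inv_unique[of y "thompson_map A B" "thompson_map B A"]
    unfolding mult one Bij by (simp add: thompson_map_in_Bij)
qed


section \<open>Refinement of trees\<close>

text \<open>Leaves are counted from 0, so that leaf \<open>k\<close> is the one immediately to the
  right of vertex \<open>k\<close>.\<close>

fun add_caret :: "nat \<Rightarrow> bintree \<Rightarrow> bintree" where
  "add_caret k Leaf = Node Leaf Leaf"
| "add_caret k (Node l r) =
     (if k < leaves l then Node (add_caret k l) r else Node l (add_caret (k - leaves l) r))"

lemma leaves_add_caret [simp]: "leaves (add_caret k T) = Suc (leaves T)"
  by (induction T arbitrary: k) auto

text \<open>Recording \<open>length Is = k\<close> ensures that carets at the same leaf of two trees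
  bisect corresponding intervals.\<close>

lemma intervals_add_caret:
  assumes "k < leaves T" "lo < hi"
  shows "\<exists>Is a b Is'. length Is = k \<and> a < b \<and> intervals (lo, hi) T = Is @ (a, b) # Is' \<and>
    intervals (lo, hi) (add_caret k T) = Is @ (a, (a + b) / 2) # ((a + b) / 2, b) # Is'"
  using assms
proof (induction T arbitrary: k lo hi)
  case Leaf
  then show ?case
    by auto
next
  case (Node l r)
  let ?m = "(lo + hi) / 2"
  have m: "lo < ?m" "?m < hi"
    using Node.prems(2) by auto
  show ?case
  proof (cases "k < leaves l")
    case True
    then obtain Is a b Is' where "length Is = k" "a < b"
      "intervals (lo, ?m) l = Is @ (a, b) # Is'"
      "intervals (lo, ?m) (add_caret k l) = Is @ (a, (a + b) / 2) # ((a + b) / 2, b) # Is'"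
      using Node.IH(1)[OF _ m(1)] by metis
    then show ?thesis
      using True
      by (intro exI[of _ Is] exI[of _ a] exI[of _ b] exI[of _ "Is' @ intervals (?m, hi) r"]) simp
  next
    case False
    then have "k - leaves l < leaves r"
      using Node.prems(1) by simp
    then obtain Is a b Is' where "length Is = k - leaves l" "a < b"
      "intervals (?m, hi) r = Is @ (a, b) # Is'"
      "intervals (?m, hi) (add_caret (k - leaves l) r)
        = Is @ (a, (a + b) / 2) # ((a + b) / 2, b) # Is'"
      using Node.IH(2)[OF _ m(2)] by metis
    then show ?thesis
      using False
      by (intro exI[of _ "intervals (lo, ?m) l @ Is"] exI[of _ a] exI[of _ b] exI[of _ Is']) simp
  qed
qed

lemma thompson_map_add_caret:
  assumes "leaves A = leaves B" "k < leaves B"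
  shows "thompson_map (add_caret k A) (add_caret k B) = thompson_map A B"
proof -
  obtain Is a b Is' where I: "length Is = k" "a < b"
    "leaf_intervals B = Is @ (a, b) # Is'"
    "leaf_intervals (add_caret k B) = Is @ (a, (a + b) / 2) # ((a + b) / 2, b) # Is'"
    using intervals_add_caret[of k B 0 1] assms(2) unfolding leaf_intervals_def by auto
  obtain Js c d Js' where J: "length Js = k" "c < d"
    "leaf_intervals A = Js @ (c, d) # Js'"
    "leaf_intervals (add_caret k A) = Js @ (c, (c + d) / 2) # ((c + d) / 2, d) # Js'"
    using intervals_add_caret[of k A 0 1] assms unfolding leaf_intervals_def by auto
  show ?thesis
    using assms(1) piecewise_affine_bisect[of Is Js a b Is' c d Js'] I J
    by (simp add: thompson_map_eq_piecewise_affine)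
qed

text \<open>Not a branch hanging at some vertex: the first tree is an initial part of the second at
  the root, so the subdivision of the second refines that of the first.\<close>

fun subtree :: "bintree \<Rightarrow> bintree \<Rightarrow> bool" where
  "subtree Leaf T \<longleftrightarrow> True"
| "subtree (Node l r) Leaf \<longleftrightarrow> False"
| "subtree (Node l r) (Node l' r') \<longleftrightarrow> subtree l l' \<and> subtree r r'"

text \<open>The union of two trees superposed at the root; its subdivision is the common refinement
  of theirs.\<close>

fun join :: "bintree \<Rightarrow> bintree \<Rightarrow> bintree" where
  "join Leaf T = T"
| "join T Leaf = T"
| "join (Node l r) (Node l' r') = Node (join l l') (join r r')"

lemma subtree_refl: "subtree T T"
  by (induction T) auto

lemma subtree_trans: "subtree R S \<Longrightarrow> subtree S T \<Longrightarrow> subtree R T"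
proof (induction R S arbitrary: T rule: subtree.induct)
  case (3 l r l' r')
  then show ?case
    by (cases T) auto
qed auto

lemma subtree_join1: "subtree S (join S T)"
  by (induction S T rule: join.induct) (auto simp: subtree_refl)

lemma subtree_join2: "subtree T (join S T)"
  by (induction S T rule: join.induct) (auto simp: subtree_refl)

text \<open>Growth by one caret towards \<open>T\<close>, which reduces refinement to statements
  about a single caret.\<close>

lemma subtree_add_caret:
  "subtree S T \<Longrightarrow> S \<noteq> T \<Longrightarrow> \<exists>k<leaves S. subtree (add_caret k S) T"
proof (induction S T rule: subtree.induct)
  case (1 T)
  then show ?case
    by (cases T) auto
next
  case (3 l r l' r')
  show ?case
  proof (cases "l = l'")
    case False
    then obtain k where "k < leaves l" "subtree (add_caret k l) l'"
      using 3 by auto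
    then show ?thesis
      using 3 by (intro exI[of _ k]) auto
  next
    case True
    then obtain k where "k < leaves r" "subtree (add_caret k r) r'"
      using 3 by auto
    then show ?thesis
      using 3 by (intro exI[of _ "leaves l + k"]) auto
  qed
qed auto

lemma leaves_subtree: "subtree S T \<Longrightarrow> leaves S \<le> leaves T"
  by (induction S T rule: subtree.induct) (auto simp: Suc_le_eq add_mono)

lemma common_refinement: "\<exists>T. \<forall>i<r. subtree (S i) T" for r :: nat
proof (induction r)
  case (Suc r)
  then obtain T where "\<forall>i<r. subtree (S i) T"
    by blast
  then show ?case
    by (intro exI[of _ "join T (S r)"])
      (auto simp: less_Suc_eq subtree_join2 intro: subtree_trans[OF _ subtree_join1])
qed simp


section \<open>Boundary colourings of half-plane tangles\<close>

text \<open>\<open>r v\<close> and \<open>l v\<close> are the colours of the segments crossing the \<open>x\<close>-axis to the right and to the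
  left of the vertex \<open>v\<close>. \<open>outgoing\<close> is the colour reached at the leftmost vertex \<open>s\<close> of a subtree
  after passing the arches of that subtree, starting from \<open>r s\<close>.\<close>

fun outgoing :: "nat \<Rightarrow> (nat \<Rightarrow> int) \<Rightarrow> (nat \<Rightarrow> int) \<Rightarrow> nat \<Rightarrow> bintree \<Rightarrow> int" where
  "outgoing Q r l s Leaf = r s"
| "outgoing Q r l s (Node a b) = (2 * outgoing Q r l s a - l (s + leaves a)) mod int Q"

text \<open>The over-strand of the root arch meets the segment leaving the left subtree at
  \<open>s\<close> and the one leaving the right subtree at \<open>s + leaves a\<close>, so these
  two colours must agree. The relation for the under-arcs gives no further condition: it defines the
  next outgoing colour.\<close>

fun consistent :: "nat \<Rightarrow> (nat \<Rightarrow> int) \<Rightarrow> (nat \<Rightarrow> int) \<Rightarrow> nat \<Rightarrow> bintree \<Rightarrow> bool" where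
  "consistent Q r l s Leaf \<longleftrightarrow> True"
| "consistent Q r l s (Node a b) \<longleftrightarrow>
     consistent Q r l s a \<and> consistent Q r l (s + leaves a) b \<and>
     outgoing Q r l s a = outgoing Q r l (s + leaves a) b"

text \<open>Vertex 0 is the right end of no arch. Its left colour is therefore what remains after
  passing all arches at 0, whence the last condition.\<close>

definition boundary_colourings :: "nat \<Rightarrow> bintree \<Rightarrow> ((nat \<Rightarrow> int) \<times> (nat \<Rightarrow> int)) set" where
  "boundary_colourings Q T = {(r, l).
     r \<in> {..<leaves T} \<rightarrow>\<^sub>E {0..<int Q} \<and> l \<in> {..<leaves T} \<rightarrow>\<^sub>E {0..<int Q} \<and>
     consistent Q r l 0 T \<and> l 0 = outgoing Q r l 0 T}"

lemma finite_boundary_colourings [simp]: "finite (boundary_colourings Q T)"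
proof (rule finite_subset)
  let ?P = "{..<leaves T} \<rightarrow>\<^sub>E {0..<int Q}"
  show "boundary_colourings Q T \<subseteq> ?P \<times> ?P"
    by (auto simp: boundary_colourings_def)
  show "finite (?P \<times> ?P)"
    by (intro finite_cartesian_product finite_PiE) auto
qed

lemma outgoing_cong:
  assumes "\<And>v. s \<le> v \<Longrightarrow> v < s + leaves T \<Longrightarrow> r v = r' v"
    "\<And>v. s < v \<Longrightarrow> v < s + leaves T \<Longrightarrow> l v = l' v"
  shows "outgoing Q r l s T = outgoing Q r' l' s T"
  using assms
proof (induction T)
  case (Node a b)
  have "outgoing Q r l s a = outgoing Q r' l' s a"
    using Node.prems by (intro Node.IH(1)) auto
  moreover have "l (s + leaves a) = l' (s + leaves a)"
    by (intro Node.prems(2)) auto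
  ultimately show ?case
    by simp
qed simp

lemma consistent_cong:
  assumes "\<And>v. s \<le> v \<Longrightarrow> v < s + leaves T \<Longrightarrow> r v = r' v"
    "\<And>v. s < v \<Longrightarrow> v < s + leaves T \<Longrightarrow> l v = l' v"
  shows "consistent Q r l s T = consistent Q r' l' s T"
  using assms
proof (induction T arbitrary: s)
  case (Node a b)
  have "consistent Q r l s a = consistent Q r' l' s a"
    "consistent Q r l (s + leaves a) b = consistent Q r' l' (s + leaves a) b"
    using Node.prems by (auto intro!: Node.IH)
  moreover have "outgoing Q r l s a = outgoing Q r' l' s a"
    "outgoing Q r l (s + leaves a) b = outgoing Q r' l' (s + leaves a) b"
    using Node.prems by (auto intro!: outgoing_cong)
  ultimately show ?case
    by simp
qed simp

lemma outgoing_Suc: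
  "outgoing Q r l (Suc s) T = outgoing Q (\<lambda>i. r (Suc i)) (\<lambda>i. l (Suc i)) s T"
  by (induction T) auto

lemma consistent_Suc:
  "consistent Q r l (Suc s) T = consistent Q (\<lambda>i. r (Suc i)) (\<lambda>i. l (Suc i)) s T"
  by (induction T arbitrary: s) (auto simp: outgoing_Suc)

text \<open>A caret at leaf \<open>k\<close> splits vertex \<open>k\<close> into \<open>k\<close> and \<open>k + 1\<close>, joined by an innermost
  arch. Deleting it leaves the colour \<open>2 r\<^sub>k - l\<^sub>k\<^sub>+\<^sub>1\<close> to the right of vertex \<open>k\<close>.\<close>

definition contract_right ::
    "nat \<Rightarrow> nat \<Rightarrow> (nat \<Rightarrow> int) \<Rightarrow> (nat \<Rightarrow> int) \<Rightarrow> nat \<Rightarrow> int" where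
  "contract_right Q k r l i =
     (if i < k then r i else if i = k then (2 * r k - l (Suc k)) mod int Q else r (Suc i))"

definition contract_left :: "nat \<Rightarrow> (nat \<Rightarrow> int) \<Rightarrow> nat \<Rightarrow> int" where
  "contract_left k l i = (if i \<le> k then l i else l (Suc i))"

definition expand_right :: "nat \<Rightarrow> int \<Rightarrow> (nat \<Rightarrow> int) \<Rightarrow> nat \<Rightarrow> int" where
  "expand_right k t r i = (if i < k then r i else if i \<le> Suc k then t else r (i - 1))"

definition expand_left ::
    "nat \<Rightarrow> nat \<Rightarrow> int \<Rightarrow> (nat \<Rightarrow> int) \<Rightarrow> (nat \<Rightarrow> int) \<Rightarrow> nat \<Rightarrow> int" where
  "expand_left Q k t r l i =
     (if i \<le> k then l i else if i = Suc k then (2 * t - r k) mod int Q else l (i - 1))"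

lemma outgoing_add_caret:
  assumes "s \<le> k" "k < s + leaves T"
  shows "outgoing Q r l s (add_caret (k - s) T)
    = outgoing Q (contract_right Q k r l) (contract_left k l) s T"
  using assms
proof (induction T)
  case (Node a b)
  show ?case
  proof (cases "k < s + leaves a")
    case False
    have "outgoing Q r l s a = outgoing Q (contract_right Q k r l) (contract_left k l) s a"
      using False by (intro outgoing_cong) (auto simp: contract_right_def contract_left_def)
    moreover have "contract_left k l (s + leaves a) = l (s + leaves a)"
      using False by (simp add: contract_left_def)
    ultimately show ?thesis
      using False by auto
  qed (use Node in \<open>auto simp: contract_left_def\<close>)
next
  case Leaf
  then have "k = s"
    by simp
  then show ?case
    by (simp add: contract_right_def)
qed

text \<open>Contraction preserves all the old conditions; the new innermost arch contributes the
  equality of the two colours entering it.\<close>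

lemma consistent_add_caret:
  assumes "s \<le> k" "k < s + leaves T"
  shows "consistent Q r l s (add_caret (k - s) T) \<longleftrightarrow>
    consistent Q (contract_right Q k r l) (contract_left k l) s T \<and> r k = r (Suc k)"
  using assms
proof (induction T arbitrary: s)
  case (Node a b)
  let ?r = "contract_right Q k r l" and ?l = "contract_left k l"
  show ?case
  proof (cases "k < s + leaves a")
    case True
    \<comment> \<open>The caret in \<open>a\<close> adds a vertex, so all vertices of
      \<open>b\<close> move up by one; \<open>outgoing_Suc\<close> moves them back.\<close>
    have "outgoing Q r l (Suc (s + leaves a)) b = outgoing Q ?r ?l (s + leaves a) b"
      unfolding outgoing_Suc using True
      by (intro outgoing_cong) (auto simp: contract_right_def contract_left_def)
    moreover have "consistent Q r l (Suc (s + leaves a)) b = consistent Q ?r ?l (s + leaves a) b"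
      unfolding consistent_Suc using True
      by (intro consistent_cong) (auto simp: contract_right_def contract_left_def)
    moreover have "outgoing Q r l s (add_caret (k - s) a) = outgoing Q ?r ?l s a"
      using True Node.prems by (intro outgoing_add_caret)
    ultimately show ?thesis
      using True Node by auto
  next
    case False
    have "outgoing Q r l s a = outgoing Q ?r ?l s a"
      using False by (intro outgoing_cong) (auto simp: contract_right_def contract_left_def)
    moreover have "consistent Q r l s a = consistent Q ?r ?l s a"
      using False by (intro consistent_cong) (auto simp: contract_right_def contract_left_def)
    moreover have "k - s - leaves a = k - (s + leaves a)"
      by simp
    moreover have "outgoing Q r l (s + leaves a) (add_caret (k - (s + leaves a)) b)
        = outgoing Q ?r ?l (s + leaves a) b"
      using False Node.prems by (intro outgoing_add_caret) auto
    ultimately show ?thesis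
      using False Node by auto
  qed
next
  case Leaf
  then have "k = s"
    by simp
  then show ?case
    by simp
qed

lemma boundary_colourings_add_caret:
  assumes "k < leaves T" "r \<in> {..<Suc (leaves T)} \<rightarrow>\<^sub>E {0..<int Q}"
    "l \<in> {..<Suc (leaves T)} \<rightarrow>\<^sub>E {0..<int Q}"
  shows "(r, l) \<in> boundary_colourings Q (add_caret k T) \<longleftrightarrow>
    (contract_right Q k r l, contract_left k l) \<in> boundary_colourings Q T \<and> r k = r (Suc k)"
proof -
  \<comment> \<open>The colour \<open>r 0\<close> lies in the range of colours, which would be empty
    for \<open>Q = 0\<close>.\<close>
  have Q: "0 < int Q"
    using PiE_mem[OF assms(2), of 0] by auto
  have range: "r i \<in> {0..<int Q}" "l i \<in> {0..<int Q}" if "i < Suc (leaves T)" for i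
    using that PiE_mem[OF assms(2), of i] PiE_mem[OF assms(3), of i] by simp_all
  have undef: "r i = undefined" "l i = undefined" if "\<not> i < Suc (leaves T)" for i
    using that PiE_arb[OF assms(2), of i] PiE_arb[OF assms(3), of i] by simp_all
  have "contract_right Q k r l \<in> {..<leaves T} \<rightarrow>\<^sub>E {0..<int Q}"
  proof (intro PiE_I)
    fix i assume "i \<in> {..<leaves T}"
    then show "contract_right Q k r l i \<in> {0..<int Q}"
      using range[of i] range[of "Suc i"] Q by (simp add: contract_right_def)
  qed (use assms(1) undef in \<open>auto simp: contract_right_def\<close>)
  moreover have "contract_left k l \<in> {..<leaves T} \<rightarrow>\<^sub>E {0..<int Q}"
  proof (intro PiE_I)
    fix i assume "i \<in> {..<leaves T}"
    then show "contract_left k l i \<in> {0..<int Q}"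
      using range[of i] range[of "Suc i"] Q by (simp add: contract_left_def)
  qed (use assms(1) undef in \<open>auto simp: contract_left_def\<close>)
  moreover have "contract_left k l 0 = l 0"
    by (simp add: contract_left_def)
  ultimately show ?thesis
    using assms consistent_add_caret[of 0 k T Q r l] outgoing_add_caret[of 0 k T Q r l]
    by (auto simp: boundary_colourings_def)
qed

text \<open>Reflection in \<open>t\<close> is an involution on residues, which makes contraction and
  expansion of a caret mutually inverse.\<close>

lemma mod_reflect:
  assumes "x \<in> {0..<int Q}"
  shows "(2 * t - (2 * t - x) mod int Q) mod int Q = x"
proof -
  have "(2 * t - (2 * t - x) mod int Q) mod int Q = (2 * t - (2 * t - x)) mod int Q"
    by (simp only: mod_diff_right_eq)
  then show ?thesis
    using assms by simp
qed

text \<open>Contraction depends on the leaf \<open>k\<close> but not on the tree, so a single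
  bijection works for both trees and hence for the intersection. Its extra component is the common
  colour of \<open>r k\<close> and \<open>r (Suc k)\<close>, the over-strand of the caret arch,
  which is a free residue.\<close>

lemma card_boundary_colourings_add_caret:
  assumes "leaves A = leaves B" "k < leaves B"
  shows "card (boundary_colourings Q (add_caret k A) \<inter> boundary_colourings Q (add_caret k B))
    = Q * card (boundary_colourings Q A \<inter> boundary_colourings Q B)"
proof -
  let ?V = "boundary_colourings Q A \<inter> boundary_colourings Q B"
  let ?V' = "boundary_colourings Q (add_caret k A) \<inter> boundary_colourings Q (add_caret k B)"
  let ?n = "leaves B"
  define f where "f = (\<lambda>(r, l). ((contract_right Q k r l, contract_left k l), r k))"
  define g where "g = (\<lambda>((r, l), t). (expand_right k t r, expand_left Q k t r l))"
  have fun': "r \<in> {..<Suc ?n} \<rightarrow>\<^sub>E {0..<int Q}" "l \<in> {..<Suc ?n} \<rightarrow>\<^sub>E {0..<int Q}"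
    if "(r, l) \<in> ?V'" for r l
    using that assms by (auto simp: boundary_colourings_def)
  have fun_: "r \<in> {..<?n} \<rightarrow>\<^sub>E {0..<int Q}" "l \<in> {..<?n} \<rightarrow>\<^sub>E {0..<int Q}"
    if "(r, l) \<in> ?V" for r l
    using that assms by (auto simp: boundary_colourings_def)
  have V': "(r, l) \<in> ?V' \<longleftrightarrow> (contract_right Q k r l, contract_left k l) \<in> ?V \<and> r k = r (Suc k)"
    if "r \<in> {..<Suc ?n} \<rightarrow>\<^sub>E {0..<int Q}" "l \<in> {..<Suc ?n} \<rightarrow>\<^sub>E {0..<int Q}" for r l
    using that assms boundary_colourings_add_caret[of k A r Q l]
      boundary_colourings_add_caret[of k B r Q l] by auto
  have gf: "g (f (r, l)) = (r, l)" if "(r, l) \<in> ?V'" for r l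
  proof -
    have "r k = r (Suc k)"
      using V' fun'[OF that] that by blast
    moreover have "l (Suc k) \<in> {0..<int Q}"
      using PiE_mem[OF fun'(2)[OF that], of "Suc k"] assms by simp
    ultimately have "expand_right k (r k) (contract_right Q k r l) i = r i"
      "expand_left Q k (r k) (contract_right Q k r l) (contract_left k l) i = l i" for i
      by (auto simp: expand_right_def expand_left_def contract_right_def contract_left_def
          mod_reflect le_Suc_eq not_less not_le Suc_le_eq)
    then show ?thesis
      by (auto simp: f_def g_def)
  qed
  have fg: "f (g ((r, l), t)) = ((r, l), t)" and g: "g ((r, l), t) \<in> ?V'"
    if rl: "(r, l) \<in> ?V" and t: "t \<in> {0..<int Q}" for r l t
  proof -
    have range: "r i \<in> {0..<int Q}" "l i \<in> {0..<int Q}" if "i < ?n" for i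
      using that PiE_mem[OF fun_(1)[OF rl], of i] PiE_mem[OF fun_(2)[OF rl], of i] by simp_all
    have undef: "r i = undefined" "l i = undefined" if "\<not> i < ?n" for i
      using that PiE_arb[OF fun_(1)[OF rl], of i] PiE_arb[OF fun_(2)[OF rl], of i] by simp_all
    have c: "contract_right Q k (expand_right k t r) (expand_left Q k t r l) = r"
      "contract_left k (expand_left Q k t r l) = l"
      using mod_reflect[OF range(1)[OF assms(2)], of t]
      by (auto simp: expand_right_def expand_left_def contract_right_def contract_left_def)
    show "f (g ((r, l), t)) = ((r, l), t)"
      using c by (simp add: f_def g_def expand_right_def)
    have "expand_right k t r \<in> {..<Suc ?n} \<rightarrow>\<^sub>E {0..<int Q}"
    proof (intro PiE_I)
      fix i assume "i \<in> {..<Suc ?n}"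
      then show "expand_right k t r i \<in> {0..<int Q}"
        using range[of i] range[of "i - 1"] t assms(2) by (simp add: expand_right_def)
    qed (use assms(2) undef in \<open>auto simp: expand_right_def\<close>)
    moreover have "expand_left Q k t r l \<in> {..<Suc ?n} \<rightarrow>\<^sub>E {0..<int Q}"
    proof (intro PiE_I)
      fix i assume "i \<in> {..<Suc ?n}"
      then show "expand_left Q k t r l i \<in> {0..<int Q}"
        using range[of i] range[of "i - 1"] t assms(2) by (simp add: expand_left_def)
    qed (use assms(2) undef in \<open>auto simp: expand_left_def\<close>)
    ultimately show "g ((r, l), t) \<in> ?V'"
      unfolding g_def prod.case by (subst V') (use rl c in \<open>auto simp: expand_right_def\<close>)
  qed
  have f: "f (r, l) \<in> ?V \<times> {0..<int Q}" if "(r, l) \<in> ?V'" for r l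
    using that V'[OF fun'[OF that]] PiE_mem[OF fun'(1)[OF that], of k] assms(2)
    by (simp add: f_def)
  have "bij_betw f ?V' (?V \<times> {0..<int Q})"
    by (rule bij_betwI[where g = g]) (use f g fg gf in auto)
  then have "card ?V' = card (?V \<times> {0..<int Q})"
    by (rule bij_betw_same_card)
  then show ?thesis
    by (simp add: card_cartesian_product)
qed


section \<open>Colourings of half-plane tangles\<close>

lemma leaves_neq_0 [simp]: "leaves T \<noteq> 0"
  using leaves_pos[of T] by linarith

lemma arches_bounds: "(i, j) \<in> arches s T \<Longrightarrow> s \<le> i \<and> i < j \<and> j < s + leaves T"
proof (induction T arbitrary: s)
  case (Node a b)
  then show ?case
    by (force simp: Suc_le_eq)
qed simp

lemma finite_arches [simp]: "finite (arches s T)"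
  by (induction T arbitrary: s) auto

text \<open>The root arch lies outside all others at its two ends, hence comes last: the list gives
  the order in which the darts at \<open>v\<close> are met on a walk from the right side of the axis
  to the left. \<open>neighbours_eq\<close> identifies it with the order used in
  \<open>half_star\<close>.\<close>

fun neighbours :: "nat \<Rightarrow> bintree \<Rightarrow> nat \<Rightarrow> nat list" where
  "neighbours s Leaf v = []"
| "neighbours s (Node a b) v =
     (if v < s + leaves a
      then neighbours s a v @ (if v = s then [s + leaves a] else [])
      else neighbours (s + leaves a) b v @ (if v = s + leaves a then [s] else []))"

lemma set_neighbours: "set (neighbours s T v) = {w. (v, w) \<in> arches s T \<or> (w, v) \<in> arches s T}"
  by (induction T arbitrary: s) (auto dest: arches_bounds)

lemma set_neighbours_Node:
  "w \<in> set (neighbours s (Node a b) v) \<longleftrightarrow>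
     w \<in> set (neighbours s a v) \<or> w \<in> set (neighbours (s + leaves a) b v) \<or>
     v = s \<and> w = s + leaves a \<or> v = s + leaves a \<and> w = s"
  unfolding set_neighbours by auto

lemma neighbours_bounds:
  assumes "w \<in> set (neighbours s T v)"
  shows "s \<le> v" "v < s + leaves T" "s \<le> w" "w < s + leaves T" "v \<noteq> w"
  using assms unfolding set_neighbours by (auto dest: arches_bounds)

lemma distinct_neighbours: "distinct (neighbours s T v)"
  by (induction T arbitrary: s) (auto simp: set_neighbours dest: arches_bounds)

lemma neighbours_nonempty:
  assumes "s \<le> v" "v < s + leaves T" "1 < leaves T"
  shows "neighbours s T v \<noteq> []"
proof -
  \<comment> \<open>Every vertex except the leftmost is the right end of an arch; only the leftmost
    one requires a second leaf.\<close>
  have "neighbours s T v \<noteq> []" if "s < v" "v < s + leaves T" for s T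
    using that by (induction T arbitrary: s) auto
  then show ?thesis
    using assms by (cases "s = v"; cases T) auto
qed

lemma sorted_list_of_set_insert_greatest:
  fixes m :: "'a :: linorder"
  assumes "finite A" "\<And>x. x \<in> A \<Longrightarrow> x < m"
  shows "sorted_list_of_set (insert m A) = sorted_list_of_set A @ [m]"
proof -
  have "m \<notin> A"
    using assms(2) by blast
  then show ?thesis
    using assms by (simp add: sorted_insort_is_snoc less_imp_le)
qed

lemma finite_arches_targets: "finite {w. (v, w) \<in> arches s T}"
  by (rule finite_subset[of _ "snd ` arches s T"]) force+

lemma neighbours_eq:
  "neighbours s T v = sorted_list_of_set {w. (v, w) \<in> arches s T}
     @ sorted_list_of_set {u. (u, v) \<in> arches s T}"
proof (induction T arbitrary: s)
  case (Node a b)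
  let ?m = "s + leaves a"
  consider "v = s" | "v < ?m" "v \<noteq> s" | "v = ?m" | "?m < v"
    by linarith
  then show ?case
  proof cases
    case 1
    have "{w. (v, w) \<in> arches s (Node a b)} = insert ?m {w. (v, w) \<in> arches s a}"
      using 1 by (auto dest: arches_bounds)
    moreover have "{u. (u, v) \<in> arches s (Node a b)} = {}" "{u. (u, v) \<in> arches s a} = {}"
      using 1 by (auto dest: arches_bounds)
    moreover have "sorted_list_of_set (insert ?m {w. (v, w) \<in> arches s a})
        = sorted_list_of_set {w. (v, w) \<in> arches s a} @ [?m]"
      using finite_arches_targets
      by (intro sorted_list_of_set_insert_greatest) (auto dest: arches_bounds)
    ultimately show ?thesis
      using 1 Node.IH(1)[of s] by simp
  next
    case 2
    have "{w. (v, w) \<in> arches s (Node a b)} = {w. (v, w) \<in> arches s a}"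
      "{u. (u, v) \<in> arches s (Node a b)} = {u. (u, v) \<in> arches s a}"
      using 2 by (auto dest: arches_bounds)
    then show ?thesis
      using 2 Node.IH(1)[of s] by simp
  next
    case 3
    have "{w. (v, w) \<in> arches s (Node a b)} = {w. (v, w) \<in> arches ?m b}"
      "{u. (u, v) \<in> arches s (Node a b)} = {s}" "{u. (u, v) \<in> arches ?m b} = {}"
      using 3 by (auto dest: arches_bounds)
    then show ?thesis
      using 3 Node.IH(2)[of ?m] by simp
  next
    case 4
    have "{w. (v, w) \<in> arches s (Node a b)} = {w. (v, w) \<in> arches ?m b}"
      "{u. (u, v) \<in> arches s (Node a b)} = {u. (u, v) \<in> arches ?m b}"
      using 4 by (auto dest: arches_bounds)
    then show ?thesis
      using 4 Node.IH(2)[of ?m] by simp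
  qed
qed simp

text \<open>Walking around a vertex from the starting colour \<open>c\<close>, past darts \<open>xs\<close> with \<open>h w\<close> the
  colour just after the dart \<open>w\<close>.\<close>

fun colour_before :: "'c \<Rightarrow> ('a \<Rightarrow> 'c) \<Rightarrow> 'a list \<Rightarrow> 'a \<Rightarrow> 'c" where
  "colour_before c h [] w = c"
| "colour_before c h (x # xs) w = (if x = w then c else colour_before (h x) h xs w)"

fun colour_end :: "'c \<Rightarrow> ('a \<Rightarrow> 'c) \<Rightarrow> 'a list \<Rightarrow> 'c" where
  "colour_end c h [] = c"
| "colour_end c h (x # xs) = colour_end (h x) h xs"

lemma colour_before_append:
  "w \<in> set xs \<Longrightarrow> colour_before c h (xs @ ys) w = colour_before c h xs w"
  by (induction xs arbitrary: c) auto

lemma colour_before_snoc: "w \<notin> set xs \<Longrightarrow> colour_before c h (xs @ [w]) w = colour_end c h xs"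
  by (induction xs arbitrary: c) auto

lemma colour_end_snoc [simp]: "colour_end c h (xs @ [w]) = h w"
  by (induction xs arbitrary: c) auto

lemma colour_before_cong:
  "(\<And>x. x \<in> set xs \<Longrightarrow> h x = h' x) \<Longrightarrow> colour_before c h xs w = colour_before c h' xs w"
  by (induction xs arbitrary: c) auto

lemma colour_end_cong:
  "(\<And>x. x \<in> set xs \<Longrightarrow> h x = h' x) \<Longrightarrow> colour_end c h xs = colour_end c h' xs"
  by (induction xs arbitrary: c) auto

lemma colour_before_in: "c \<in> A \<Longrightarrow> (\<And>x. x \<in> set xs \<Longrightarrow> h x \<in> A) \<Longrightarrow> colour_before c h xs w \<in> A"
  by (induction xs arbitrary: c) auto

section \<open>Walks around the vertices of one half plane\<close>

definition dart_before ::
    "(nat \<Rightarrow> int) \<Rightarrow> (nat \<Rightarrow> nat \<Rightarrow> int) \<Rightarrow> nat \<Rightarrow> bintree \<Rightarrow> nat \<Rightarrow> nat \<Rightarrow> int" where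
  "dart_before r h s T v w = colour_before (r v) (h v) (neighbours s T v) w"

definition vertex_end ::
    "(nat \<Rightarrow> int) \<Rightarrow> (nat \<Rightarrow> nat \<Rightarrow> int) \<Rightarrow> nat \<Rightarrow> bintree \<Rightarrow> nat \<Rightarrow> int" where
  "vertex_end r h s T v = colour_end (r v) (h v) (neighbours s T v)"

text \<open>At a crossing the over-strand consists of the segments just before the two darts of the
  arch, the under-strand of those just after them. Hence the equality expresses continuation of the
  over-arc, and the congruence is the relation for the under-arcs.\<close>

definition tangle_colouring ::
    "nat \<Rightarrow> (nat \<Rightarrow> int) \<Rightarrow> (nat \<Rightarrow> nat \<Rightarrow> int) \<Rightarrow> nat \<Rightarrow> bintree \<Rightarrow> bool" where
  "tangle_colouring Q r h s T \<longleftrightarrow> (\<forall>(i, j)\<in>arches s T.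
     dart_before r h s T i j = dart_before r h s T j i \<and>
     [h i j + h j i = 2 * dart_before r h s T i j] (mod int Q))"

lemma vertex_end_Node:
  "vertex_end r h s (Node a b) v =
    (if v = s then h s (s + leaves a)
     else if v = s + leaves a then h (s + leaves a) s
     else if v < s + leaves a then vertex_end r h s a v
     else vertex_end r h (s + leaves a) b v)"
  by (auto simp: vertex_end_def)

text \<open>The root arch comes last in the walks around its ends, so it cannot affect a colour met
  before a dart of a subtree.\<close>

lemma dart_before_Node:
  shows "(i, j) \<in> arches s a \<Longrightarrow> dart_before r h s (Node a b) i j = dart_before r h s a i j"
    and "(i, j) \<in> arches s a \<Longrightarrow> dart_before r h s (Node a b) j i = dart_before r h s a j i"
    and "(i, j) \<in> arches (s + leaves a) b \<Longrightarrow>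
      dart_before r h s (Node a b) i j = dart_before r h (s + leaves a) b i j"
    and "(i, j) \<in> arches (s + leaves a) b \<Longrightarrow>
      dart_before r h s (Node a b) j i = dart_before r h (s + leaves a) b j i"
  by (auto simp: dart_before_def set_neighbours intro!: colour_before_append dest: arches_bounds)

lemma dart_before_root:
  shows "dart_before r h s (Node a b) s (s + leaves a) = vertex_end r h s a s"
    and "dart_before r h s (Node a b) (s + leaves a) s
      = vertex_end r h (s + leaves a) b (s + leaves a)"
proof -
  have "s + leaves a \<notin> set (neighbours s a s)"
    using neighbours_bounds(4) by blast
  then show "dart_before r h s (Node a b) s (s + leaves a) = vertex_end r h s a s"
    by (simp add: dart_before_def vertex_end_def colour_before_snoc)
  have "s \<notin> set (neighbours (s + leaves a) b (s + leaves a))"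
    using neighbours_bounds(3)[of s "s + leaves a" b "s + leaves a"] leaves_pos[of a] by linarith
  then show "dart_before r h s (Node a b) (s + leaves a) s
      = vertex_end r h (s + leaves a) b (s + leaves a)"
    by (simp add: dart_before_def vertex_end_def colour_before_snoc)
qed

lemma tangle_colouring_Node:
  "tangle_colouring Q r h s (Node a b) \<longleftrightarrow>
     tangle_colouring Q r h s a \<and> tangle_colouring Q r h (s + leaves a) b \<and>
     vertex_end r h s a s = vertex_end r h (s + leaves a) b (s + leaves a) \<and>
     [h s (s + leaves a) + h (s + leaves a) s = 2 * vertex_end r h s a s] (mod int Q)"
proof -
  let ?P = "\<lambda>s T (i, j). dart_before r h s T i j = dart_before r h s T j i \<and>
     [h i j + h j i = 2 * dart_before r h s T i j] (mod int Q)"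
  have "(\<forall>e\<in>arches s a. ?P s (Node a b) e) \<longleftrightarrow> (\<forall>e\<in>arches s a. ?P s a e)"
    by (intro ball_cong refl) (auto simp: dart_before_Node)
  moreover have "(\<forall>e\<in>arches (s + leaves a) b. ?P s (Node a b) e)
      \<longleftrightarrow> (\<forall>e\<in>arches (s + leaves a) b. ?P (s + leaves a) b e)"
    by (intro ball_cong refl) (auto simp: dart_before_Node)
  ultimately show ?thesis
    unfolding tangle_colouring_def arches.simps ball_Un
    by (simp add: dart_before_root conj_ac)
qed

lemma tangle_colouring_cong:
  assumes "\<And>v w. w \<in> set (neighbours s T v) \<Longrightarrow> h v w = h' v w"
  shows "tangle_colouring Q r h s T \<longleftrightarrow> tangle_colouring Q r h' s T"
proof -
  have "dart_before r h s T v w = dart_before r h' s T v w" for v w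
    unfolding dart_before_def using assms by (intro colour_before_cong)
  moreover have "h i j = h' i j" "h j i = h' j i" if "(i, j) \<in> arches s T" for i j
    using assms that by (auto simp: set_neighbours)
  ultimately show ?thesis
    unfolding tangle_colouring_def by (intro ball_cong refl) auto
qed

text \<open>As colours are canonical residues, the relation at a crossing yields one under-arc as a
  reflection of the other.\<close>

lemma cong_reflect:
  assumes "x \<in> {0..<int Q}"
  shows "[x + y = 2 * c] (mod int Q) \<longleftrightarrow> x = (2 * c - y) mod int Q"
proof -
  have "[x + y = 2 * c] (mod int Q) \<longleftrightarrow> [x = 2 * c - y] (mod int Q)"
    by (simp add: cong_iff_dvd_diff algebra_simps)
  then show ?thesis
    using assms by (simp add: cong_def)
qed

text \<open>The root arch is the last dart at its right end, so the colour after it there is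
  prescribed by \<open>l\<close>; the relation at the crossing then gives the colour at the left
  end, which is the recursion of \<open>outgoing\<close>. The over-strand gives
  \<open>consistent\<close>.\<close>

lemma tangle_colouring_outgoing:
  assumes "tangle_colouring Q r h s T"
    "\<And>v w. w \<in> set (neighbours s T v) \<Longrightarrow> h v w \<in> {0..<int Q}"
    "\<And>v. s < v \<Longrightarrow> v < s + leaves T \<Longrightarrow> vertex_end r h s T v = l v"
  shows "vertex_end r h s T s = outgoing Q r l s T \<and> consistent Q r l s T"
  using assms
proof (induction T arbitrary: s)
  case Leaf
  then show ?case
    by (simp add: vertex_end_def)
next
  case (Node a b)
  let ?m = "s + leaves a"
  have a: "vertex_end r h s a s = outgoing Q r l s a \<and> consistent Q r l s a"
  proof (rule Node.IH)
    show "vertex_end r h s a v = l v" if "s < v" "v < s + leaves a" for v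
      using that Node.prems(3)[of v] by (simp add: vertex_end_Node)
    show "h v w \<in> {0..<int Q}" if "w \<in> set (neighbours s a v)" for v w
      by (rule Node.prems(2)) (simp add: set_neighbours_Node that del: neighbours.simps)
  qed (use Node.prems in \<open>simp add: tangle_colouring_Node\<close>)
  have b: "vertex_end r h ?m b ?m = outgoing Q r l ?m b \<and> consistent Q r l ?m b"
  proof (rule Node.IH)
    show "vertex_end r h ?m b v = l v" if "?m < v" "v < ?m + leaves b" for v
      using that Node.prems(3)[of v] by (simp add: vertex_end_Node)
    show "h v w \<in> {0..<int Q}" if "w \<in> set (neighbours ?m b v)" for v w
      by (rule Node.prems(2)) (simp add: set_neighbours_Node that del: neighbours.simps)
  qed (use Node.prems in \<open>simp add: tangle_colouring_Node\<close>)
  have "h s ?m \<in> {0..<int Q}"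
    by (rule Node.prems(2)) (auto simp: set_neighbours)
  moreover have "h ?m s = l ?m"
    using Node.prems(3)[of ?m] by (simp add: vertex_end_Node)
  ultimately have "h s ?m = (2 * outgoing Q r l s a - l ?m) mod int Q"
    using Node.prems(1) a cong_reflect by (simp add: tangle_colouring_Node)
  then show ?case
    using a b Node.prems(1) by (simp add: vertex_end_Node tangle_colouring_Node)
qed

text \<open>The colours just after the root arch are end colours of vertices: the right one is
  given, the left one equals \<open>outgoing\<close>, a function of the boundary data. The remaining
  darts belong to the subtrees, which inherit the end colours at all vertices but their
  leftmost.\<close>

lemma tangle_colouring_unique:
  assumes "tangle_colouring Q r h s T" "tangle_colouring Q r h' s T"
    "\<And>v w. w \<in> set (neighbours s T v) \<Longrightarrow> h v w \<in> {0..<int Q}"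
    "\<And>v w. w \<in> set (neighbours s T v) \<Longrightarrow> h' v w \<in> {0..<int Q}"
    "\<And>v. s < v \<Longrightarrow> v < s + leaves T \<Longrightarrow> vertex_end r h s T v = vertex_end r h' s T v"
    "w \<in> set (neighbours s T v)"
  shows "h v w = h' v w"
  using assms
proof (induction T arbitrary: s)
  case (Node a b)
  let ?m = "s + leaves a"
  have sub: "w \<in> set (neighbours s (Node a b) v)"
    if "w \<in> set (neighbours s a v) \<or> w \<in> set (neighbours ?m b v)" for v w
    using that by (auto simp: set_neighbours_Node simp del: neighbours.simps)
  have range: "h v w \<in> {0..<int Q}" "h' v w \<in> {0..<int Q}"
    if "w \<in> set (neighbours s a v) \<or> w \<in> set (neighbours ?m b v)" for v w
    using Node.prems(3,4) sub[OF that] by blast+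
  have "vertex_end r h s (Node a b) s = outgoing Q r (vertex_end r h s (Node a b)) s (Node a b)"
    using tangle_colouring_outgoing Node.prems(1,3) by blast
  moreover have "vertex_end r h' s (Node a b) s
      = outgoing Q r (vertex_end r h' s (Node a b)) s (Node a b)"
    using tangle_colouring_outgoing Node.prems(2,4) by blast
  moreover have "outgoing Q r (vertex_end r h s (Node a b)) s (Node a b)
      = outgoing Q r (vertex_end r h' s (Node a b)) s (Node a b)"
    by (rule outgoing_cong) (use Node.prems(5) in auto)
  ultimately have s: "h s ?m = h' s ?m"
    by (simp add: vertex_end_Node)
  have m: "h ?m s = h' ?m s"
    using Node.prems(5)[of ?m] by (simp add: vertex_end_Node)
  have "w \<in> set (neighbours s a v) \<or> w \<in> set (neighbours ?m b v)
      \<or> v = s \<and> w = ?m \<or> v = ?m \<and> w = s"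
    using Node.prems(6) by (simp only: set_neighbours_Node)
  then show ?case
  proof (elim disjE)
    assume w: "w \<in> set (neighbours s a v)"
    show ?thesis
    proof (rule Node.IH(1))
      show "vertex_end r h s a v = vertex_end r h' s a v" if "s < v" "v < s + leaves a" for v
        using that Node.prems(5)[of v] by (simp add: vertex_end_Node)
    qed (use Node.prems(1,2) range w in \<open>simp_all add: tangle_colouring_Node\<close>)
  next
    assume w: "w \<in> set (neighbours ?m b v)"
    show ?thesis
    proof (rule Node.IH(2))
      show "vertex_end r h ?m b v = vertex_end r h' ?m b v" if "?m < v" "v < ?m + leaves b" for v
        using that Node.prems(5)[of v] by (simp add: vertex_end_Node)
    qed (use Node.prems(1,2) range w in \<open>simp_all add: tangle_colouring_Node\<close>)
  qed (use s m in auto)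
qed simp

lemma tangle_colouring_exists:
  assumes "0 < Q" "\<And>v. s < v \<Longrightarrow> v < s + leaves T \<Longrightarrow> l v \<in> {0..<int Q}"
    "consistent Q r l s T"
  shows "\<exists>h. tangle_colouring Q r h s T \<and>
    (\<forall>v w. w \<in> set (neighbours s T v) \<longrightarrow> h v w \<in> {0..<int Q}) \<and>
    (\<forall>v. s < v \<longrightarrow> v < s + leaves T \<longrightarrow> vertex_end r h s T v = l v)"
  using assms(2,3)
proof (induction T arbitrary: s)
  case Leaf
  then show ?case
    by (simp add: tangle_colouring_def)
next
  case (Node a b)
  let ?m = "s + leaves a"
  obtain ha where ha: "tangle_colouring Q r ha s a"
    "\<And>v w. w \<in> set (neighbours s a v) \<Longrightarrow> ha v w \<in> {0..<int Q}"
    "\<And>v. s < v \<Longrightarrow> v < s + leaves a \<Longrightarrow> vertex_end r ha s a v = l v"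
    using Node.IH(1)[of s] Node.prems by auto
  obtain hb where hb: "tangle_colouring Q r hb ?m b"
    "\<And>v w. w \<in> set (neighbours ?m b v) \<Longrightarrow> hb v w \<in> {0..<int Q}"
    "\<And>v. ?m < v \<Longrightarrow> v < ?m + leaves b \<Longrightarrow> vertex_end r hb ?m b v = l v"
    using Node.IH(2)[of ?m] Node.prems by auto
  \<comment> \<open>The subtrees share no dart, so their colourings can be glued. At the root arch
    the right end takes the prescribed colour and the left end the reflected one that the crossing
    forces.\<close>
  define h where "h = (\<lambda>v w. if v = s \<and> w = ?m then (2 * outgoing Q r l s a - l ?m) mod int Q
    else if v = ?m \<and> w = s then l ?m else if v < ?m then ha v w else hb v w)"
  have h_a: "h v w = ha v w" if "w \<in> set (neighbours s a v)" for v w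
    using neighbours_bounds[OF that] by (simp add: h_def)
  have h_b: "h v w = hb v w" if "w \<in> set (neighbours ?m b v)" for v w
    using neighbours_bounds[OF that] by (simp add: h_def)
  have end_a: "vertex_end r h s a v = vertex_end r ha s a v" for v
    unfolding vertex_end_def by (intro colour_end_cong h_a)
  have end_b: "vertex_end r h ?m b v = vertex_end r hb ?m b v" for v
    unfolding vertex_end_def by (intro colour_end_cong h_b)
  have out_a: "vertex_end r ha s a s = outgoing Q r l s a"
    using tangle_colouring_outgoing[OF ha] by simp
  have out_b: "vertex_end r hb ?m b ?m = outgoing Q r l ?m b"
    using tangle_colouring_outgoing[OF hb] by simp
  have "tangle_colouring Q r h s a" "tangle_colouring Q r h ?m b"
    using ha(1) hb(1) tangle_colouring_cong[of s a h ha Q r] tangle_colouring_cong[of ?m b h hb Q r]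
      h_a h_b by auto
  moreover have "h s ?m = (2 * outgoing Q r l s a - l ?m) mod int Q" "h ?m s = l ?m"
    by (auto simp: h_def)
  moreover have "(2 * outgoing Q r l s a - l ?m) mod int Q \<in> {0..<int Q}" "l ?m \<in> {0..<int Q}"
    using assms(1) Node.prems(1)[of ?m] by simp_all
  moreover have "h v w \<in> {0..<int Q}"
    if w: "w \<in> set (neighbours s (Node a b) v)" for v w
  proof -
    have "w \<in> set (neighbours s a v) \<or> w \<in> set (neighbours ?m b v)
        \<or> v = s \<and> w = ?m \<or> v = ?m \<and> w = s"
      using w by (simp only: set_neighbours_Node)
    then show ?thesis
      using ha(2) hb(2) h_a h_b calculation by (metis (no_types))
  qed
  ultimately show ?case
    using ha(3) hb(3) Node.prems(2)
    by (intro exI[of _ h])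
      (auto simp: tangle_colouring_Node vertex_end_Node end_a end_b out_a out_b cong_reflect)
qed


section \<open>Colourings of link diagrams\<close>

text \<open>Constancy along over-strands becomes an explicit condition, so that all conditions are
  local at crossings and no quotient intervenes.\<close>

definition segment_colourings :: "nat \<Rightarrow> ('s, 'c) link_diagram \<Rightarrow> ('s \<Rightarrow> int) set" where
  "segment_colourings Q D = {F \<in> segments D \<rightarrow>\<^sub>E {0..<int Q}. \<forall>c\<in>crossings D.
     F (fst (over D c)) = F (snd (over D c)) \<and>
     [F (fst (under D c)) + F (snd (under D c)) = 2 * F (fst (over D c))] (mod int Q)}"

lemma equiv_arc_rel: "equiv (segments D) (arc_rel D)"
  by (rule equivI)
    (auto simp: arc_rel_def refl_on_def sym_def trans_def
      intro: equivclp_sym equivclp_trans)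

text \<open>Functions on the quotient by a generated equivalence are the functions compatible with
  its generators, here the overcrossings.\<close>

lemma Col_eq_card_segment_colourings:
  assumes "\<And>c. c \<in> crossings D \<Longrightarrow> fst (over D c) \<in> segments D \<and> snd (over D c) \<in> segments D"
    "\<And>c. c \<in> crossings D \<Longrightarrow> fst (under D c) \<in> segments D \<and> snd (under D c) \<in> segments D"
  shows "Col Q D = card (segment_colourings Q D)"
proof -
  let ?\<Phi> = "\<lambda>f. \<lambda>s\<in>segments D. f (arc_of D s)"
  have arc_of: "arc_of D s \<in> arcs D" if "s \<in> segments D" for s
    using that by (simp add: arcs_def arc_of_def quotientI)
  have arc_over: "arc_of D (fst (over D c)) = arc_of D (snd (over D c))" if "c \<in> crossings D" for c
    unfolding arc_of_def
  proof (rule equiv_class_eq[OF equiv_arc_rel])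
    have "equivclp (\<lambda>s t. \<exists>c\<in>crossings D. over D c = (s, t)) (fst (over D c)) (snd (over D c))"
      by (intro r_into_equivclp bexI[OF _ that]) simp
    then show "(fst (over D c), snd (over D c)) \<in> arc_rel D"
      using assms(1)[OF that] unfolding arc_rel_def by (intro CollectI case_prodI conjI) auto
  qed
  have "bij_betw ?\<Phi> (colourings Q D) (segment_colourings Q D)"
    unfolding bij_betw_def
  proof (intro conjI inj_onI equalityI subsetI)
    fix f g
    assume fg: "f \<in> colourings Q D" "g \<in> colourings Q D" "?\<Phi> f = ?\<Phi> g"
    show "f = g"
    proof (rule extensionalityI)
      show "f \<in> extensional (arcs D)" "g \<in> extensional (arcs D)"
        using fg by (auto simp: colourings_def PiE_def)
      fix A
      assume "A \<in> arcs D"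
      then obtain s where "s \<in> segments D" "A = arc_of D s"
        by (auto simp: arcs_def arc_of_def elim: quotientE)
      then show "f A = g A"
        using fun_cong[OF fg(3), of s] by simp
    qed
  next
    fix F
    assume "F \<in> ?\<Phi> ` colourings Q D"
    then obtain f where f: "f \<in> colourings Q D" "F = ?\<Phi> f"
      by blast
    have "F \<in> segments D \<rightarrow>\<^sub>E {0..<int Q}"
      unfolding f(2) using f(1) arc_of by (intro restrict_PiE_iff[THEN iffD2]) (auto simp: colourings_def)
    then show "F \<in> segment_colourings Q D"
      using f assms arc_over by (auto simp: segment_colourings_def colourings_def)
  next
    fix F
    assume F: "F \<in> segment_colourings Q D"
    \<comment> \<open>A representative of each arc is chosen; by \<open>const\<close> the choice is
      immaterial.\<close>
    define f where "f = (\<lambda>A\<in>arcs D. F (SOME s. s \<in> A))"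
    have const: "F s = F t" if "equivclp (\<lambda>s t. \<exists>c\<in>crossings D. over D c = (s, t)) s t" for s t
      using that
    proof (induction rule: equivclp_induct)
      case (step y z)
      then obtain c where "c \<in> crossings D" "over D c = (y, z) \<or> over D c = (z, y)"
        by blast
      then have "F y = F z"
        using F by (force simp: segment_colourings_def)
      then show ?case
        using step by simp
    qed simp
    have f_arc: "f (arc_of D s) = F s" if "s \<in> segments D" for s
    proof -
      have "s \<in> arc_of D s"
        using that equiv_class_self[OF equiv_arc_rel] by (simp add: arc_of_def)
      moreover define t where "t = (SOME t. t \<in> arc_of D s)"
      ultimately have "t \<in> arc_of D s"
        by (metis someI)
      then have "F s = F t"
        by (intro const) (simp add: arc_of_def arc_rel_def)
      then show ?thesis
        using arc_of[OF that] by (simp add: f_def t_def)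
    qed
    have "f \<in> arcs D \<rightarrow>\<^sub>E {0..<int Q}"
    proof (intro PiE_I)
      fix A
      assume "A \<in> arcs D"
      then obtain s where "s \<in> segments D" "A = arc_of D s"
        by (auto simp: arcs_def arc_of_def elim: quotientE)
      then show "f A \<in> {0..<int Q}"
        using F f_arc[of s] PiE_mem[of F "segments D" "\<lambda>_. {0..<int Q}" s]
        by (simp add: segment_colourings_def)
    qed (simp add: f_def)
    moreover have "[f (arc_of D (fst (under D c))) + f (arc_of D (snd (under D c)))
        = 2 * f (arc_of D (fst (over D c)))] (mod int Q)" if c: "c \<in> crossings D" for c
    proof -
      have "[F (fst (under D c)) + F (snd (under D c)) = 2 * F (fst (over D c))] (mod int Q)"
        using F c unfolding segment_colourings_def by blast
      then show ?thesis
        using assms[OF c] by (simp only: f_arc)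
    qed
    ultimately have "f \<in> colourings Q D"
      by (simp add: colourings_def)
    moreover have "F = ?\<Phi> f"
    proof (rule extensionalityI)
      show "F \<in> extensional (segments D)"
        using F by (simp add: segment_colourings_def PiE_def)
    qed (use f_arc in auto)
    ultimately show "F \<in> ?\<Phi> ` colourings Q D"
      by blast
  qed
  then show ?thesis
    unfolding Col_def by (rule bij_betw_same_card)
qed

section \<open>Successors in a cycle, for the rotation at a vertex\<close>

lemma cycle_of_list_next:
  assumes "distinct (us @ x # y # vs)"
  shows "cycle_of_list (us @ x # y # vs) x = y"
  using assms
proof (induction us)
  case Nil
  then have "cycle_of_list (y # vs) x = x"
    by (intro id_outside_supp) auto
  then show ?case
    by simp
next
  case (Cons a us)
  obtain b zs where b: "us @ x # y # vs = b # zs"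
    by (cases us) auto
  then have "b \<noteq> y"
    using Cons.prems by (cases us) auto
  moreover have "a \<noteq> y"
    using Cons.prems by simp
  moreover have "cycle_of_list (us @ x # y # vs) x = y"
    using Cons by simp
  ultimately show ?case
    using b by (simp add: transpose_apply_other)
qed

text \<open>The cycle is a product of adjacent transpositions, which carry the last entry step by
  step to the front.\<close>

lemma cycle_of_list_last: "distinct (y # us @ [x]) \<Longrightarrow> cycle_of_list (y # us @ [x]) x = y"
proof (induction us arbitrary: y)
  case (Cons a us)
  then have "cycle_of_list (a # us @ [x]) x = a"
    by simp
  then show ?case
    by simp
qed simp

lemma colour_before_next:
  "distinct (us @ u # w # vs) \<Longrightarrow> colour_before c h (us @ u # w # vs) w = h u"
  by (induction us arbitrary: c) auto

lemma colour_end_last: "xs \<noteq> [] \<Longrightarrow> colour_end c h xs = h (last xs)"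
  by (induction xs arbitrary: c) auto

lemma first_or_preceded:
  assumes "w \<in> set xs"
  obtains vs where "xs = w # vs" | us u vs where "xs = us @ u # w # vs"
proof -
  obtain us vs where "xs = us @ w # vs"
    using assms by (meson split_list)
  then show thesis
    using that by (cases us rule: rev_cases) auto
qed

lemma last_or_succeeded:
  assumes "w \<in> set xs"
  obtains us where "xs = us @ [w]" | us u vs where "xs = us @ w # u # vs"
proof -
  obtain us vs where "xs = us @ w # vs"
    using assms by (meson split_list)
  then show thesis
    using that by (cases vs) auto
qed

lemma boundary_colouringsD:
  assumes "(r, l) \<in> boundary_colourings Q T"
  shows "r \<in> {..<leaves T} \<rightarrow>\<^sub>E {0..<int Q}" "l \<in> {..<leaves T} \<rightarrow>\<^sub>E {0..<int Q}"
    "consistent Q r l 0 T" "l 0 = outgoing Q r l 0 T"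
  using assms unfolding boundary_colourings_def by blast+

text \<open>With at least two leaves every vertex has darts in both half planes. Then there is no
  free circle, and exactly one segment crosses the axis on each side of each vertex.\<close>

locale tree_pair =
  fixes Tp Tm :: bintree
  assumes same_leaves: "leaves Tp = leaves Tm" and several_leaves: "1 < leaves Tm"
begin

abbreviation nbs :: "sign \<Rightarrow> nat \<Rightarrow> nat list" where
  "nbs s \<equiv> neighbours 0 (case s of Positive \<Rightarrow> Tp | Negative \<Rightarrow> Tm)"

abbreviation (input) n :: nat where "n \<equiv> leaves Tm"

abbreviation cw :: "dart \<Rightarrow> dart" where "cw \<equiv> clockwise (Gamma Tp Tm)"

lemma nbs_nonempty: "v < n \<Longrightarrow> nbs s v \<noteq> []"
  using same_leaves several_leaves neighbours_nonempty[of 0 v Tp] neighbours_nonempty[of 0 v Tm]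
  by (cases s) simp_all

lemma nbs_bounds: "w \<in> set (nbs s v) \<Longrightarrow> v < n"
  using same_leaves by (cases s) (auto dest: neighbours_bounds(2))

lemma edges_Gamma: "(s, i, j) \<in> edges (Gamma Tp Tm) \<longleftrightarrow>
    (i, j) \<in> arches 0 (case s of Positive \<Rightarrow> Tp | Negative \<Rightarrow> Tm)"
  by (cases s) (auto simp: Gamma_def)

lemma darts_Gamma: "(s, v, w) \<in> darts (Gamma Tp Tm) \<longleftrightarrow> w \<in> set (nbs s v)"
  by (auto simp: darts_def edges_Gamma set_neighbours)

lemma half_star_Gamma: "half_star (Gamma Tp Tm) s v = map (\<lambda>w. (s, v, w)) (nbs s v)"
  by (simp add: half_star_def edges_Gamma neighbours_eq)

text \<open>Clockwise from the positive x-direction come the lower darts in the order of the walk,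
  then the upper darts against it. The four successor lemmas read off the steps within a half plane
  and the two steps across the axis.\<close>

lemma clockwise_Gamma: "cw (s, v, w) = cycle_of_list
    (map (\<lambda>w. (Negative, v, w)) (nbs Negative v)
      @ rev (map (\<lambda>w. (Positive, v, w)) (nbs Positive v))) (s, v, w)"
  by (simp add: clockwise_def star_def half_star_Gamma)

lemma distinct_star: "distinct (map (\<lambda>w. (Negative, v, w)) (nbs Negative v)
      @ rev (map (\<lambda>w. (Positive, v, w)) (nbs Positive v)))"
  by (auto simp: distinct_map distinct_neighbours inj_on_def)

lemma clockwise_Positive_first:
  assumes "nbs Positive v = w # vs" "v < n"
  shows "cw (Positive, v, w) = (Negative, v, hd (nbs Negative v))"
proof -
  obtain y ys where "nbs Negative v = y # ys"
    using nbs_nonempty[OF assms(2)] by (meson list.exhaust)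
  then show ?thesis
    using assms distinct_star[of v]
      cycle_of_list_last[of "(Negative, v, y)"
        "map (\<lambda>w. (Negative, v, w)) ys @ rev (map (\<lambda>w. (Positive, v, w)) vs)"
        "(Positive, v, w)"]
    by (simp add: clockwise_Gamma)
qed

lemma clockwise_Positive_next:
  assumes "nbs Positive v = us @ u # w # vs"
  shows "cw (Positive, v, w) = (Positive, v, u)"
  using assms distinct_star[of v]
    cycle_of_list_next[of "map (\<lambda>w. (Negative, v, w)) (nbs Negative v)
      @ rev (map (\<lambda>w. (Positive, v, w)) vs)" "(Positive, v, w)" "(Positive, v, u)"
      "rev (map (\<lambda>w. (Positive, v, w)) us)"]
  by (simp add: clockwise_Gamma)

lemma clockwise_Negative_next:
  assumes "nbs Negative v = us @ w # u # vs"
  shows "cw (Negative, v, w) = (Negative, v, u)"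
  using assms distinct_star[of v]
    cycle_of_list_next[of "map (\<lambda>w. (Negative, v, w)) us" "(Negative, v, w)" "(Negative, v, u)"
      "map (\<lambda>w. (Negative, v, w)) vs @ rev (map (\<lambda>w. (Positive, v, w)) (nbs Positive v))"]
  by (simp add: clockwise_Gamma)

lemma clockwise_Negative_last:
  assumes "nbs Negative v = us @ [w]" "v < n"
  shows "cw (Negative, v, w) = (Positive, v, last (nbs Positive v))"
proof -
  obtain ys y where "nbs Positive v = ys @ [y]"
    using nbs_nonempty[OF assms(2)] by (meson rev_exhaust)
  then show ?thesis
    using assms distinct_star[of v]
      cycle_of_list_next[of "map (\<lambda>w. (Negative, v, w)) us" "(Negative, v, w)" "(Positive, v, y)"
        "rev (map (\<lambda>w. (Positive, v, w)) ys)"]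
    by (simp add: clockwise_Gamma)
qed

lemma clockwise_in_darts:
  assumes "d \<in> darts (Gamma Tp Tm)"
  shows "cw d \<in> darts (Gamma Tp Tm)"
proof -
  obtain s v w where d: "d = (s, v, w)"
    by (cases d) auto
  then have w: "w \<in> set (nbs s v)"
    using assms darts_Gamma by simp
  note v = nbs_bounds[OF w]
  have hd_last: "hd (nbs s v) \<in> set (nbs s v)" "last (nbs s v) \<in> set (nbs s v)" for s
    using nbs_nonempty[OF v, of s] by simp_all
  show ?thesis
  proof (cases s)
    case Positive
    then have "w \<in> set (nbs Positive v)"
      using w by simp
    then show ?thesis
    proof (cases rule: first_or_preceded)
      case (1 vs)
      then show ?thesis
        using clockwise_Positive_first[OF _ v] hd_last(1)[of Negative]
        by (simp add: d Positive darts_Gamma)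
    next
      case (2 us u vs)
      then show ?thesis
        using clockwise_Positive_next by (simp add: d Positive darts_Gamma)
    qed
  next
    case Negative
    then have "w \<in> set (nbs Negative v)"
      using w by simp
    then show ?thesis
    proof (cases rule: last_or_succeeded)
      case (1 us)
      then show ?thesis
        using clockwise_Negative_last[OF _ v] hd_last(2)[of Positive]
        by (simp add: d Negative darts_Gamma)
    next
      case (2 us u vs)
      then show ?thesis
        using clockwise_Negative_next by (simp add: d Negative darts_Gamma)
    qed
  qed
qed

lemma segments_L: "segments (L Tp Tm) = Corner ` darts (Gamma Tp Tm)"
proof -
  have "\<exists>s w. (s, v, w) \<in> darts (Gamma Tp Tm)" if "v < n" for v
    unfolding darts_Gamma using nbs_nonempty[OF that, of Positive] hd_in_set by blast
  then have "{v \<in> verts (Gamma Tp Tm). \<forall>s w. (s, v, w) \<notin> darts (Gamma Tp Tm)} = {}"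
    using same_leaves by (auto simp: Gamma_def)
  then show ?thesis
    unfolding L_def medial_diagram_def
    by (simp only: link_diagram.simps image_empty Un_empty_right)
qed

lemma Col_L_eq_segment_colourings: "Col Q (L Tp Tm) = card (segment_colourings Q (L Tp Tm))"
proof (rule Col_eq_card_segment_colourings)
  fix c
  assume c: "c \<in> crossings (L Tp Tm)"
  obtain s i j where c_eq: "c = (s, i, j)"
    by (cases c) auto
  have "(s, i, j) \<in> darts (Gamma Tp Tm)" "(s, j, i) \<in> darts (Gamma Tp Tm)"
    using c by (auto simp: c_eq L_def medial_diagram_def darts_def)
  then show "fst (over (L Tp Tm) c) \<in> segments (L Tp Tm) \<and> snd (over (L Tp Tm) c) \<in> segments (L Tp Tm)"
    "fst (under (L Tp Tm) c) \<in> segments (L Tp Tm) \<and> snd (under (L Tp Tm) c) \<in> segments (L Tp Tm)"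
    unfolding segments_L using clockwise_in_darts
    by (auto simp: c_eq L_def medial_diagram_def rising_def falling_def)
qed

text \<open>\<open>Corner d\<close> lies counterclockwise of \<open>d\<close>, so the segment across
  the positive x-direction is named after the first lower dart, the last one of the star. Likewise
  the segment of \<open>left_boundary\<close> is named after the last upper dart.\<close>

definition right_boundary :: "(medial_edge \<Rightarrow> int) \<Rightarrow> nat \<Rightarrow> int" where
  "right_boundary F = (\<lambda>v\<in>{..<n}. F (Corner (Negative, v, hd (nbs Negative v))))"

definition left_boundary :: "(medial_edge \<Rightarrow> int) \<Rightarrow> nat \<Rightarrow> int" where
  "left_boundary F = (\<lambda>v\<in>{..<n}. F (Corner (Positive, v, last (nbs Positive v))))"

definition upper :: "(medial_edge \<Rightarrow> int) \<Rightarrow> nat \<Rightarrow> nat \<Rightarrow> int" where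
  "upper F v w = F (Corner (Positive, v, w))"

text \<open>In the lower half plane vertices are walked around clockwise, as in the mirror image.\<close>

definition lower :: "(medial_edge \<Rightarrow> int) \<Rightarrow> nat \<Rightarrow> nat \<Rightarrow> int" where
  "lower F v w = F (Corner (cw (Negative, v, w)))"

lemma dart_before_upper:
  assumes "w \<in> set (nbs Positive v)"
  shows "dart_before (right_boundary F) (upper F) 0 Tp v w = F (Corner (cw (Positive, v, w)))"
  using assms
proof (cases rule: first_or_preceded)
  case (1 vs)
  then show ?thesis
    using clockwise_Positive_first[OF 1] nbs_bounds[OF assms]
    by (simp add: dart_before_def right_boundary_def)
next
  case (2 us u vs)
  have "distinct (us @ u # w # vs)"
    using distinct_neighbours[of 0 Tp v] 2 by simp
  then show ?thesis
    using 2 clockwise_Positive_next[OF 2]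
    by (simp add: dart_before_def upper_def colour_before_next)
qed

lemma dart_before_lower:
  assumes "w \<in> set (nbs Negative v)"
  shows "dart_before (right_boundary F) (lower F) 0 Tm v w = F (Corner (Negative, v, w))"
  using assms
proof (cases rule: first_or_preceded)
  case (1 vs)
  then show ?thesis
    using nbs_bounds[OF assms] by (simp add: dart_before_def right_boundary_def)
next
  case (2 us u vs)
  have "distinct (us @ u # w # vs)"
    using distinct_neighbours[of 0 Tm v] 2 by simp
  then show ?thesis
    using 2 clockwise_Negative_next[OF 2]
    by (simp add: dart_before_def lower_def colour_before_next)
qed

lemma vertex_end_upper:
  "v < n \<Longrightarrow> vertex_end r (upper F) 0 Tp v = left_boundary F v"
  using nbs_nonempty[of v Positive]
  by (simp add: vertex_end_def colour_end_last upper_def left_boundary_def)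

lemma vertex_end_lower:
  assumes "v < n"
  shows "vertex_end r (lower F) 0 Tm v = left_boundary F v"
proof -
  obtain ys y where "nbs Negative v = ys @ [y]"
    using nbs_nonempty[OF assms] by (meson rev_exhaust)
  then show ?thesis
    using assms clockwise_Negative_last[of v ys y]
    by (simp add: vertex_end_def lower_def left_boundary_def)
qed

text \<open>The mirror symmetry enters here. At an upper arch the rising strand is over and joins
  the segments clockwise of the two darts; at a lower arch the falling strand is over and joins
  those counterclockwise of them. Both are the segments before the darts in the respective walks, so
  one predicate describes both half planes.\<close>

lemma segment_colourings_L:
  "F \<in> segment_colourings Q (L Tp Tm) \<longleftrightarrow>
     F \<in> Corner ` darts (Gamma Tp Tm) \<rightarrow>\<^sub>E {0..<int Q} \<and>
     tangle_colouring Q (right_boundary F) (upper F) 0 Tp \<and>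
     tangle_colouring Q (right_boundary F) (lower F) 0 Tm"
proof -
  define P where "P = (\<lambda>e. F (fst (over (L Tp Tm) e)) = F (snd (over (L Tp Tm) e)) \<and>
     [F (fst (under (L Tp Tm) e)) + F (snd (under (L Tp Tm) e))
       = 2 * F (fst (over (L Tp Tm) e))] (mod int Q))"
  let ?r = "right_boundary F"
  have "P (Positive, i, j) \<longleftrightarrow>
      dart_before ?r (upper F) 0 Tp i j = dart_before ?r (upper F) 0 Tp j i \<and>
      [upper F i j + upper F j i = 2 * dart_before ?r (upper F) 0 Tp i j] (mod int Q)"
    if "(i, j) \<in> arches 0 Tp" for i j
    using that dart_before_upper[of j i F] dart_before_upper[of i j F]
    by (simp add: P_def set_neighbours L_def medial_diagram_def rising_def falling_def upper_def)
  then have "(\<forall>(i, j)\<in>arches 0 Tp. P (Positive, i, j)) \<longleftrightarrow> tangle_colouring Q ?r (upper F) 0 Tp"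
    unfolding tangle_colouring_def by (intro ball_cong refl) (simp only: split_paired_all case_prod_conv)
  moreover have "P (Negative, i, j) \<longleftrightarrow>
      dart_before ?r (lower F) 0 Tm i j = dart_before ?r (lower F) 0 Tm j i \<and>
      [lower F i j + lower F j i = 2 * dart_before ?r (lower F) 0 Tm i j] (mod int Q)"
    if "(i, j) \<in> arches 0 Tm" for i j
    using that dart_before_lower[of j i F] dart_before_lower[of i j F]
    by (simp add: P_def set_neighbours L_def medial_diagram_def rising_def falling_def lower_def)
  then have "(\<forall>(i, j)\<in>arches 0 Tm. P (Negative, i, j)) \<longleftrightarrow> tangle_colouring Q ?r (lower F) 0 Tm"
    unfolding tangle_colouring_def by (intro ball_cong refl) (simp only: split_paired_all case_prod_conv)
  moreover have "crossings (L Tp Tm) = {Positive} \<times> arches 0 Tp \<union> {Negative} \<times> arches 0 Tm"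
    by (simp add: L_def medial_diagram_def Gamma_def)
  then have "(\<forall>e\<in>crossings (L Tp Tm). P e) \<longleftrightarrow>
      (\<forall>(i, j)\<in>arches 0 Tp. P (Positive, i, j)) \<and> (\<forall>(i, j)\<in>arches 0 Tm. P (Negative, i, j))"
    by auto
  ultimately show ?thesis
    unfolding segment_colourings_def segments_L P_def by simp
qed

lemma Corner_range:
  assumes "F \<in> Corner ` darts (Gamma Tp Tm) \<rightarrow>\<^sub>E A" "w \<in> set (nbs s v)"
  shows "F (Corner (s, v, w)) \<in> A" "F (Corner (cw (s, v, w))) \<in> A"
  using assms by (auto simp: darts_Gamma intro!: PiE_mem[OF assms(1)] imageI clockwise_in_darts)

lemma upper_range:
  "F \<in> Corner ` darts (Gamma Tp Tm) \<rightarrow>\<^sub>E A \<Longrightarrow> w \<in> set (neighbours 0 Tp v) \<Longrightarrow> upper F v w \<in> A"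
  using Corner_range(1)[of F A w Positive v] by (simp add: upper_def)

lemma lower_range:
  "F \<in> Corner ` darts (Gamma Tp Tm) \<rightarrow>\<^sub>E A \<Longrightarrow> w \<in> set (neighbours 0 Tm v) \<Longrightarrow> lower F v w \<in> A"
  using Corner_range(2)[of F A w Negative v] by (simp add: lower_def)

lemma segment_colouring_boundary:
  assumes "F \<in> segment_colourings Q (L Tp Tm)"
  shows "(right_boundary F, left_boundary F) \<in> boundary_colourings Q Tp \<inter> boundary_colourings Q Tm"
proof -
  have F: "F \<in> Corner ` darts (Gamma Tp Tm) \<rightarrow>\<^sub>E {0..<int Q}"
    "tangle_colouring Q (right_boundary F) (upper F) 0 Tp"
    "tangle_colouring Q (right_boundary F) (lower F) 0 Tm"
    using assms by (simp_all add: segment_colourings_L)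
  have "right_boundary F \<in> {..<n} \<rightarrow>\<^sub>E {0..<int Q}" "left_boundary F \<in> {..<n} \<rightarrow>\<^sub>E {0..<int Q}"
    unfolding right_boundary_def left_boundary_def restrict_PiE_iff
    using Corner_range(1)[OF F(1) hd_in_set[OF nbs_nonempty], of _ Negative]
      Corner_range(1)[OF F(1) last_in_set[OF nbs_nonempty], of _ Positive]
    by (simp_all del: atLeastLessThan_iff)
  moreover have "0 < n"
    using several_leaves by simp
  moreover have "vertex_end (right_boundary F) (upper F) 0 Tp 0
        = outgoing Q (right_boundary F) (left_boundary F) 0 Tp
      \<and> consistent Q (right_boundary F) (left_boundary F) 0 Tp"
    using upper_range[OF F(1)] vertex_end_upper same_leaves
    by (intro tangle_colouring_outgoing[OF F(2)]) simp_all
  moreover have "vertex_end (right_boundary F) (lower F) 0 Tm 0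
        = outgoing Q (right_boundary F) (left_boundary F) 0 Tm
      \<and> consistent Q (right_boundary F) (left_boundary F) 0 Tm"
    using lower_range[OF F(1)] vertex_end_lower
    by (intro tangle_colouring_outgoing[OF F(3)]) simp_all
  ultimately show ?thesis
    using same_leaves vertex_end_upper[of 0] vertex_end_lower[of 0]
    by (simp add: boundary_colourings_def)
qed

lemma segment_colouring_eqI:
  assumes F: "F \<in> segment_colourings Q (L Tp Tm)" and F': "F' \<in> segment_colourings Q (L Tp Tm)"
    and r: "right_boundary F = right_boundary F'" and l: "left_boundary F = left_boundary F'"
  shows "F = F'"
proof (rule extensionalityI)
  have PiE: "F \<in> Corner ` darts (Gamma Tp Tm) \<rightarrow>\<^sub>E {0..<int Q}"
    "F' \<in> Corner ` darts (Gamma Tp Tm) \<rightarrow>\<^sub>E {0..<int Q}"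
    using F F' by (simp_all add: segment_colourings_L)
  then show "F \<in> extensional (Corner ` darts (Gamma Tp Tm))"
    "F' \<in> extensional (Corner ` darts (Gamma Tp Tm))"
    by (simp_all add: PiE_def)
  have upper: "upper F v w = upper F' v w" if "w \<in> set (neighbours 0 Tp v)" for v w
  proof (rule tangle_colouring_unique[OF _ _ upper_range[OF PiE(1)] upper_range[OF PiE(2)] _ that])
    show "tangle_colouring Q (right_boundary F) (upper F) 0 Tp"
      "tangle_colouring Q (right_boundary F) (upper F') 0 Tp"
      using F F' r by (simp_all add: segment_colourings_L)
  qed (use same_leaves vertex_end_upper l in simp_all)
  have lower: "lower F v w = lower F' v w" if "w \<in> set (neighbours 0 Tm v)" for v w
  proof (rule tangle_colouring_unique[OF _ _ lower_range[OF PiE(1)] lower_range[OF PiE(2)] _ that])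
    show "tangle_colouring Q (right_boundary F) (lower F) 0 Tm"
      "tangle_colouring Q (right_boundary F) (lower F') 0 Tm"
      using F F' r by (simp_all add: segment_colourings_L)
  qed (use vertex_end_lower l in simp_all)
  fix e
  assume "e \<in> Corner ` darts (Gamma Tp Tm)"
  then obtain s v w where e: "e = Corner (s, v, w)" and w: "w \<in> set (nbs s v)"
    by (auto simp: darts_Gamma)
  show "F e = F' e"
  proof (cases s)
    case Positive
    then show ?thesis
      using upper[of w v] w by (simp add: e upper_def)
  next
    case Negative
    \<comment> \<open>A lower corner is the segment before its dart in the clockwise walk, so it is
      recovered from the right boundary and \<open>lower\<close>.\<close>
    have "dart_before (right_boundary F) (lower F) 0 Tm v w
        = dart_before (right_boundary F) (lower F') 0 Tm v w"
      unfolding dart_before_def by (intro colour_before_cong lower)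
    then show ?thesis
      using dart_before_lower[of w v F] dart_before_lower[of w v F'] w Negative r
      by (simp add: e)
  qed
qed

lemma segment_colouring_exists:
  assumes Q: "0 < Q" and rl: "(r, l) \<in> boundary_colourings Q Tp \<inter> boundary_colourings Q Tm"
  shows "\<exists>F\<in>segment_colourings Q (L Tp Tm). right_boundary F = r \<and> left_boundary F = l"
proof -
  have r: "r \<in> {..<n} \<rightarrow>\<^sub>E {0..<int Q}" and l: "l \<in> {..<n} \<rightarrow>\<^sub>E {0..<int Q}"
    and consistent: "consistent Q r l 0 Tp" "consistent Q r l 0 Tm"
    and out: "l 0 = outgoing Q r l 0 Tp" "l 0 = outgoing Q r l 0 Tm"
    using boundary_colouringsD[of r l Q Tp] boundary_colouringsD[of r l Q Tm] rl
    by (simp_all only: Int_iff)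
  have l_range: "l v \<in> {0..<int Q}" if "v < n" for v
    using PiE_mem[OF l, of v] that by simp
  obtain hp where hp: "tangle_colouring Q r hp 0 Tp"
    "\<And>v w. w \<in> set (neighbours 0 Tp v) \<Longrightarrow> hp v w \<in> {0..<int Q}"
    "\<And>v. 0 < v \<Longrightarrow> v < 0 + leaves Tp \<Longrightarrow> vertex_end r hp 0 Tp v = l v"
    using tangle_colouring_exists[OF Q _ consistent(1)] l_range same_leaves by auto
  obtain hm where hm: "tangle_colouring Q r hm 0 Tm"
    "\<And>v w. w \<in> set (neighbours 0 Tm v) \<Longrightarrow> hm v w \<in> {0..<int Q}"
    "\<And>v. 0 < v \<Longrightarrow> v < 0 + leaves Tm \<Longrightarrow> vertex_end r hm 0 Tm v = l v"
    using tangle_colouring_exists[OF Q _ consistent(2)] l_range by auto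
  \<comment> \<open>The existence lemma says nothing about vertex 0; there the end colour is the
    outgoing one, which equals \<open>l 0\<close>.\<close>
  have end_p: "vertex_end r hp 0 Tp v = l v" if "v < n" for v
    using hp(3)[of v] tangle_colouring_outgoing[OF hp] out(1) same_leaves that by (cases "v = 0") auto
  have end_m: "vertex_end r hm 0 Tm v = l v" if "v < n" for v
    using hm(3)[of v] tangle_colouring_outgoing[OF hm] out(2) that by (cases "v = 0") auto
  \<comment> \<open>An upper corner follows its dart in the walk and gets \<open>hp\<close>, a lower
    corner precedes it and gets \<open>dart_before\<close>. The segments across the axis thereby
    receive \<open>r v\<close> and \<open>l v\<close>, where the two tangle colourings
    agree.\<close>
  define F where "F = (\<lambda>e\<in>Corner ` darts (Gamma Tp Tm). case e of
      Corner d \<Rightarrow> (case d of (s, v, w) \<Rightarrow>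
        (case s of Positive \<Rightarrow> hp v w | Negative \<Rightarrow> dart_before r hm 0 Tm v w))
    | Circle v \<Rightarrow> 0)"
  have F_p: "F (Corner (Positive, v, w)) = hp v w" if "w \<in> set (neighbours 0 Tp v)" for v w
    using that by (simp add: F_def darts_Gamma)
  have F_m: "F (Corner (Negative, v, w)) = dart_before r hm 0 Tm v w"
    if "w \<in> set (neighbours 0 Tm v)" for v w
    using that by (simp add: F_def darts_Gamma)
  have right: "right_boundary F = r"
  proof (rule extensionalityI[where A = "{..<n}"])
    show "r \<in> extensional {..<n}"
      using r by (simp add: PiE_def)
    fix v
    assume v: "v \<in> {..<n}"
    then obtain w vs where "nbs Negative v = w # vs"
      using nbs_nonempty[of v Negative] by (auto simp: neq_Nil_conv)
    then show "right_boundary F v = r v"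
      using v F_m[of w v] by (simp add: right_boundary_def dart_before_def)
  qed (simp add: right_boundary_def)
  have left: "left_boundary F = l"
  proof (rule extensionalityI[where A = "{..<n}"])
    show "l \<in> extensional {..<n}"
      using l by (simp add: PiE_def)
    fix v
    assume v: "v \<in> {..<n}"
    then obtain ws w where "nbs Positive v = ws @ [w]"
      using nbs_nonempty[of v Positive] rev_exhaust by blast
    then show "left_boundary F v = l v"
      using v F_p[of w v] end_p[of v] by (simp add: left_boundary_def vertex_end_def)
  qed (simp add: left_boundary_def)
  have upper: "upper F v w = hp v w" if "w \<in> set (neighbours 0 Tp v)" for v w
    using F_p[OF that] by (simp add: upper_def)
  have lower: "lower F v w = hm v w" if w: "w \<in> set (neighbours 0 Tm v)" for v w
  proof -
    have w': "w \<in> set (nbs Negative v)"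
      using w by simp
    then have v: "v < n"
      by (rule nbs_bounds)
    show ?thesis
      using w'
    proof (cases rule: last_or_succeeded)
      \<comment> \<open>Clockwise of the last lower dart lies the left boundary segment, coloured
        through the upper tangle; it agrees with \<open>hm\<close> because both tangles end in
        \<open>l v\<close>.\<close>
      case (1 us)
      then have "lower F v w = left_boundary F v"
        using v clockwise_Negative_last[OF 1 v] by (simp add: lower_def left_boundary_def)
      then show ?thesis
        using end_m[OF v] left 1 by (simp add: vertex_end_def)
    next
      case (2 us u vs)
      have "distinct (us @ w # u # vs)"
        using distinct_neighbours[of 0 Tm v] 2 by simp
      then show ?thesis
        using F_m[of u v] 2 clockwise_Negative_next[OF 2]
        by (simp add: lower_def dart_before_def colour_before_next)
    qed
  qed
  have "F \<in> Corner ` darts (Gamma Tp Tm) \<rightarrow>\<^sub>E {0..<int Q}"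
  proof (intro PiE_I)
    fix e
    assume "e \<in> Corner ` darts (Gamma Tp Tm)"
    then obtain s v w where e: "e = Corner (s, v, w)" and w: "w \<in> set (nbs s v)"
      by (auto simp: darts_Gamma)
    show "F e \<in> {0..<int Q}"
    proof (cases s)
      case Positive
      then show ?thesis
        using F_p[of w v] hp(2)[of w v] w by (simp add: e)
    next
      case Negative
      have "r v \<in> {0..<int Q}"
        using PiE_mem[OF r, of v] nbs_bounds[OF w] by simp
      then have "dart_before r hm 0 Tm v w \<in> {0..<int Q}"
        unfolding dart_before_def using hm(2) by (rule colour_before_in)
      then show ?thesis
        using F_m[of w v] w Negative by (simp add: e)
    qed
  qed (simp add: F_def)
  moreover have "tangle_colouring Q r (upper F) 0 Tp"
    using hp(1) tangle_colouring_cong[of 0 Tp "upper F" hp] upper by blast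
  moreover have "tangle_colouring Q r (lower F) 0 Tm"
    using hm(1) tangle_colouring_cong[of 0 Tm "lower F" hm] lower by blast
  ultimately show ?thesis
    using right left by (intro bexI[of _ F]) (simp_all add: segment_colourings_L)
qed

lemma Col_L_eq_card_boundary_colourings:
  assumes "0 < Q"
  shows "Col Q (L Tp Tm) = card (boundary_colourings Q Tp \<inter> boundary_colourings Q Tm)"
proof -
  have "bij_betw (\<lambda>F. (right_boundary F, left_boundary F)) (segment_colourings Q (L Tp Tm))
      (boundary_colourings Q Tp \<inter> boundary_colourings Q Tm)"
    unfolding bij_betw_def
  proof (intro conjI inj_onI equalityI subsetI)
    fix rl
    assume "rl \<in> boundary_colourings Q Tp \<inter> boundary_colourings Q Tm"
    then show "rl \<in> (\<lambda>F. (right_boundary F, left_boundary F)) ` segment_colourings Q (L Tp Tm)"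
      using segment_colouring_exists[OF assms, of "fst rl" "snd rl"] by force
  qed (use segment_colouring_boundary segment_colouring_eqI in auto)
  then show ?thesis
    unfolding Col_L_eq_segment_colourings by (rule bij_betw_same_card)
qed

end

text \<open>A single leaf is treated separately: the diagram is a circle without crossings, and the
  boundary colourings are the pairs with \<open>l 0 = r 0\<close>, so that both sides equal
  \<open>Q\<close>.\<close>

lemma Col_L:
  assumes "0 < Q" "leaves A = leaves B"
  shows "Col Q (L A B) = card (boundary_colourings Q A \<inter> boundary_colourings Q B)"
proof (cases "1 < leaves B")
  case True
  then interpret tree_pair A B
    using assms by unfold_locales
  show ?thesis
    using assms(1) by (rule Col_L_eq_card_boundary_colourings)
next
  case False
  have leaf: "T = Leaf" if "\<not> 1 < leaves T" for T
    using that leaves_pos by (cases T) (auto simp: not_less le_Suc_eq add_is_1)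
  have AB: "A = Leaf" "B = Leaf"
    using False assms(2) by (simp_all add: leaf)
  have "segments (L Leaf Leaf) = {Circle 0}" "crossings (L Leaf Leaf) = {}"
    by (auto simp: L_def medial_diagram_def Gamma_def darts_def)
  then have "Col Q (L Leaf Leaf) = card ({Circle 0} \<rightarrow>\<^sub>E {0..<int Q})"
    by (subst Col_eq_card_segment_colourings) (simp_all add: segment_colourings_def)
  moreover have "boundary_colourings Q Leaf = (\<lambda>r. (r, r)) ` ({..<1} \<rightarrow>\<^sub>E {0..<int Q})"
  proof -
    have "r = l" if "r \<in> {..<1} \<rightarrow>\<^sub>E {0..<int Q}" "l \<in> {..<1} \<rightarrow>\<^sub>E {0..<int Q}" "l 0 = r 0"
      for r l :: "nat \<Rightarrow> int"
      using that(3) by (intro PiE_ext[OF that(1,2)]) simp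
    then show ?thesis
      by (auto simp: boundary_colourings_def)
  qed
  ultimately show ?thesis
    by (simp add: AB card_image inj_on_def card_PiE)
qed


section \<open>Positive type\<close>

lemma Col_add_caret:
  assumes "0 < Q" "leaves A = leaves B" "k < leaves B"
  shows "Col Q (L (add_caret k A) (add_caret k B)) = Q * Col Q (L A B)"
  using assms by (simp add: Col_L card_boundary_colourings_add_caret)

text \<open>The value on a pair of trees, available before the description in \<open>Col_F\<close>
  is known to be unique.\<close>

definition normalized_Col :: "nat \<Rightarrow> bintree \<Rightarrow> bintree \<Rightarrow> complex" where
  "normalized_Col Q A B = of_nat (Col Q (L A B)) / of_nat Q ^ leaves B"

text \<open>Induction on the number of leaves that \<open>B\<close> lacks compared with
  \<open>S\<close>: each step adds a caret towards \<open>S\<close> and the matching caret to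
  \<open>A\<close>.\<close>

lemma refine_pair:
  assumes "0 < Q" "leaves A = leaves B" "subtree B S"
  shows "\<exists>A'. leaves A' = leaves S \<and> thompson_map A' S = thompson_map A B \<and>
    normalized_Col Q A' S = normalized_Col Q A B"
  using assms(2,3)
proof (induction "leaves S - leaves B" arbitrary: A B)
  case 0
  have "B = S"
  proof (rule ccontr)
    assume "B \<noteq> S"
    then obtain k where "subtree (add_caret k B) S"
      using subtree_add_caret "0.prems"(2) by blast
    then show False
      using leaves_subtree[of "add_caret k B" S] "0.hyps" by simp
  qed
  then show ?case
    using "0.prems" by blast
next
  case (Suc m)
  then have "B \<noteq> S"
    by auto
  then obtain k where k: "k < leaves B" "subtree (add_caret k B) S"
    using subtree_add_caret Suc.prems(2) by blast
  have "m = leaves S - leaves (add_caret k B)" "leaves (add_caret k A) = leaves (add_caret k B)"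
    using Suc.hyps(2) Suc.prems(1) by simp_all
  then obtain A' where "leaves A' = leaves S"
    "thompson_map A' S = thompson_map (add_caret k A) (add_caret k B)"
    "normalized_Col Q A' S = normalized_Col Q (add_caret k A) (add_caret k B)"
    using Suc.hyps(1) k(2) by blast
  moreover have "thompson_map (add_caret k A) (add_caret k B) = thompson_map A B"
    using Suc.prems(1) k(1) by (rule thompson_map_add_caret)
  moreover have "normalized_Col Q (add_caret k A) (add_caret k B) = normalized_Col Q A B"
    using assms(1) Suc.prems(1) k(1) by (simp add: normalized_Col_def Col_add_caret)
  ultimately show ?case
    by auto
qed

lemma normalized_Col_well_defined:
  assumes "0 < Q" "leaves A = leaves B" "leaves A' = leaves B'"
    "thompson_map A B = thompson_map A' B'"
  shows "normalized_Col Q A B = normalized_Col Q A' B'"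
proof -
  let ?S = "join B B'"
  obtain C where C: "leaves C = leaves ?S" "thompson_map C ?S = thompson_map A B"
    "normalized_Col Q C ?S = normalized_Col Q A B"
    using refine_pair[OF assms(1,2) subtree_join1] by blast
  obtain C' where C': "leaves C' = leaves ?S" "thompson_map C' ?S = thompson_map A' B'"
    "normalized_Col Q C' ?S = normalized_Col Q A' B'"
    using refine_pair[OF assms(1,3) subtree_join2] by blast
  have "C = C'"
    using thompson_map_inject[OF C(1) C'(1)] C(2) C'(2) assms(4) by simp
  then show ?thesis
    using C(3) C'(3) by simp
qed

lemma Col_F_thompson_map:
  assumes "0 < Q" "leaves A = leaves B"
  shows "Col_F Q (thompson_map A B) = normalized_Col Q A B"
  unfolding Col_F_def
proof (rule the_equality)
  show "\<exists>n. \<exists>T1\<in>trees n. \<exists>T2\<in>trees n. thompson_map A B = thompson_map T1 T2 \<and>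
      normalized_Col Q A B = of_nat (Col Q (L T1 T2)) / of_nat Q ^ n"
    using assms(2) unfolding normalized_Col_def
    by (intro exI[of _ "leaves B"] bexI[of _ A] bexI[of _ B] conjI refl) (simp_all add: trees_def)
next
  fix z :: complex
  assume "\<exists>n. \<exists>T1\<in>trees n. \<exists>T2\<in>trees n. thompson_map A B = thompson_map T1 T2 \<and>
      z = of_nat (Col Q (L T1 T2)) / of_nat Q ^ n"
  then obtain n T1 T2 where T: "leaves T1 = n" "leaves T2 = n"
    "thompson_map A B = thompson_map T1 T2" "z = of_nat (Col Q (L T1 T2)) / of_nat Q ^ n"
    by (auto simp: trees_def)
  then show "z = normalized_Col Q A B"
    using normalized_Col_well_defined[OF assms _ T(3)] by (simp add: normalized_Col_def)
qed

lemma thompson_group_common_representation: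
  fixes r :: nat
  assumes "\<And>i. i < r \<Longrightarrow> g i \<in> carrier thompson_group"
  obtains T S where "\<And>i. i < r \<Longrightarrow> leaves (T i) = leaves S"
    "\<And>i. i < r \<Longrightarrow> g i = thompson_map (T i) S"
proof -
  have "\<forall>i. \<exists>A B. i < r \<longrightarrow> leaves A = leaves B \<and> g i = thompson_map A B"
    using assms thompson_group_cases by metis
  then obtain A B where AB: "\<And>i. i < r \<Longrightarrow> leaves (A i) = leaves (B i)"
    "\<And>i. i < r \<Longrightarrow> g i = thompson_map (A i) (B i)"
    by metis
  obtain S where S: "\<And>i. i < r \<Longrightarrow> subtree (B i) S"
    using common_refinement[of r B] by blast
  have "\<exists>T. leaves T = leaves S \<and> g i = thompson_map T S" if "i < r" for i
    \<comment> \<open>Only the tree and the map are wanted here, so \<open>Q\<close> is instantiated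
      with 1.\<close>
    using refine_pair[OF zero_less_one AB(1)[OF that] S[OF that]] AB(2)[OF that] by auto
  then show thesis
    using that by metis
qed

lemma positive_semidefinite_card_Int:
  fixes V :: "nat \<Rightarrow> 'a set" and c :: real
  assumes "\<And>i. i < r \<Longrightarrow> finite (V i)" "0 \<le> c"
    "\<And>i j. i < r \<Longrightarrow> j < r \<Longrightarrow> A i j = of_real c * of_nat (card (V i \<inter> V j))"
  shows "positive_semidefinite r A"
proof -
  \<comment> \<open>A common finite ground set, on which all the indicator functions live.\<close>
  define U where "U = (\<Union>i<r. V i)"
  have [simp]: "finite U"
    using assms(1) by (simp add: U_def)
  have card: "of_nat (card (V i \<inter> V j)) = (\<Sum>u\<in>U. of_bool (u \<in> V i) * of_bool (u \<in> V j) :: complex)"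
    if "i < r" "j < r" for i j
  proof -
    have "V i \<inter> V j = U \<inter> (V i \<inter> V j)"
      using that by (auto simp: U_def)
    moreover have "of_nat (card (U \<inter> (V i \<inter> V j)))
        = (\<Sum>u\<in>U. of_bool (u \<in> V i) * of_bool (u \<in> V j) :: complex)"
    proof -
      have "of_nat (card (U \<inter> (V i \<inter> V j))) = (\<Sum>u\<in>U \<inter> (V i \<inter> V j). 1 :: complex)"
        by simp
      also have "\<dots> = (\<Sum>u\<in>U. if u \<in> V i \<inter> V j then 1 else 0)"
        by (rule sum.inter_restrict) simp
      also have "\<dots> = (\<Sum>u\<in>U. of_bool (u \<in> V i) * of_bool (u \<in> V j))"
        by (intro sum.cong refl) simp
      finally show ?thesis .
    qed
    ultimately show ?thesis
      by simp
  qed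
  have form: "(\<Sum>i<r. \<Sum>j<r. cnj (x i) * A i j * x j)
      = of_real (c * (\<Sum>u\<in>U. (cmod (\<Sum>i<r. of_bool (u \<in> V i) * x i))\<^sup>2))" for x
  proof -
    have "(\<Sum>i<r. \<Sum>j<r. cnj (x i) * A i j * x j)
        = (\<Sum>i<r. \<Sum>j<r. \<Sum>u\<in>U.
            of_real c * (cnj (of_bool (u \<in> V i) * x i) * (of_bool (u \<in> V j) * x j)))"
    proof (intro sum.cong refl)
      fix i j
      assume "i \<in> {..<r}" "j \<in> {..<r}"
      then have "cnj (x i) * A i j * x j = cnj (x i) *
          (of_real c * (\<Sum>u\<in>U. of_bool (u \<in> V i) * of_bool (u \<in> V j))) * x j"
        by (simp only: assms(3) card lessThan_iff)
      also have "\<dots> = (\<Sum>u\<in>U. cnj (x i) *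
          (of_real c * (of_bool (u \<in> V i) * of_bool (u \<in> V j))) * x j)"
        by (simp only: sum_distrib_left sum_distrib_right)
      also have "\<dots> = (\<Sum>u\<in>U.
          of_real c * (cnj (of_bool (u \<in> V i) * x i) * (of_bool (u \<in> V j) * x j)))"
        by (intro sum.cong refl) (simp add: of_bool_def)
      finally show "cnj (x i) * A i j * x j = \<dots>" .
    qed
    also have "\<dots> = (\<Sum>u\<in>U. \<Sum>i<r. \<Sum>j<r.
        of_real c * (cnj (of_bool (u \<in> V i) * x i) * (of_bool (u \<in> V j) * x j)))"
      by (subst sum.swap[of _ U], subst sum.swap[of _ U]) simp
    also have "\<dots> = (\<Sum>u\<in>U. of_real c *
        (cnj (\<Sum>i<r. of_bool (u \<in> V i) * x i) * (\<Sum>j<r. of_bool (u \<in> V j) * x j)))"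
      by (simp only: cnj_sum sum_product) (simp only: sum_distrib_left)
    also have "\<dots> = (\<Sum>u\<in>U. of_real c * of_real ((cmod (\<Sum>i<r. of_bool (u \<in> V i) * x i))\<^sup>2))"
      by (intro sum.cong refl arg_cong[of _ _ "\<lambda>z. of_real c * z"])
        (simp only: complex_norm_square mult.commute)
    finally show ?thesis
      by (simp add: sum_distrib_left)
  qed
  show ?thesis
    unfolding positive_semidefinite_def form
    using assms(2) by (auto simp: assms(3) Int_commute intro!: mult_nonneg_nonneg sum_nonneg)
qed

theorem theorem6p3:
  fixes Q :: nat
  assumes "Q > 0" and "odd Q"
  shows "(\<forall>n. \<forall>T1\<in>trees n. \<forall>T2\<in>trees n.
            Col_F Q (thompson_map T1 T2) = of_nat (Col Q (L T1 T2)) / of_nat Q ^ n)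
         \<and> positive_type thompson_group (Col_F Q)"
proof (intro conjI allI ballI)
  fix n T1 T2
  assume "T1 \<in> trees n" "T2 \<in> trees n"
  then show "Col_F Q (thompson_map T1 T2) = of_nat (Col Q (L T1 T2)) / of_nat Q ^ n"
    using Col_F_thompson_map[OF assms(1), of T1 T2] by (simp add: trees_def normalized_Col_def)
next
  show "positive_type thompson_group (Col_F Q)"
    unfolding positive_type_def
  proof (intro allI impI)
    fix r and g :: "nat \<Rightarrow> real \<Rightarrow> real"
    assume "\<forall>i<r. g i \<in> carrier thompson_group"
    then obtain T S where T: "\<And>i. i < r \<Longrightarrow> leaves (T i) = leaves S"
      "\<And>i. i < r \<Longrightarrow> g i = thompson_map (T i) S"
      using thompson_group_common_representation by metis
    show "positive_semidefinite r
        (\<lambda>i j. Col_F Q (g i \<otimes>\<^bsub>thompson_group\<^esub> inv\<^bsub>thompson_group\<^esub> g j))"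
    proof (rule positive_semidefinite_card_Int)
      fix i j
      assume ij: "i < r" "j < r"
      have "g i \<otimes>\<^bsub>thompson_group\<^esub> inv\<^bsub>thompson_group\<^esub> g j = thompson_map (T i) (T j)"
        using T(1)[OF ij(1)] T(1)[OF ij(2)]
        unfolding T(2)[OF ij(1)] T(2)[OF ij(2)] thompson_group_inv[OF T(1)[OF ij(2)]]
        by (intro thompson_group_mult) simp_all
      \<comment> \<open>All the \<open>T i\<close> have as many leaves as \<open>S\<close>, so the
        same power of \<open>Q\<close> normalises every entry and comes out as a scalar.\<close>
      then show "Col_F Q (g i \<otimes>\<^bsub>thompson_group\<^esub> inv\<^bsub>thompson_group\<^esub> g j)
          = of_real (1 / real Q ^ leaves S)
            * of_nat (card (boundary_colourings Q (T i) \<inter> boundary_colourings Q (T j)))"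
        using T(1)[OF ij(1)] T(1)[OF ij(2)] assms(1)
        by (simp add: Col_F_thompson_map normalized_Col_def Col_L)
    qed simp_all
  qed
qed

end
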